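(* Let $d, s \geq 1$ be integers. Up to unimodular equivalence, all but finitely many $s$-hollow lattice $d$-polytopes $P \subset \mathbb{R}^d$ admit a lattice projection onto an $s$-hollow $(d-1)$-dimensional lattice polytope. More precisely, every $s$-hollow lattice $d$-polytope that admits no lattice projection onto an $s$-hollow $(d-1)$-dimensional lattice polytope has volume at most \[ s^d \left(8(d-1)(8s+7)^{2^{2d-1}} + 1\right)^d. \]
   Context: A lattice polytope in $\mathbb{R}^k$ is the convex hull of finitely many points of $\mathbb{Z}^k$; a $k$-polytope is full-dimensional. For a positive integer $s$ and a lattice $k$-polytope $P\subset\mathbb{R}^k$, set $I_s(P) := \mathrm{int}(P) \cap s\mathbb{Z}^k$; $P$ is $s$-hollow if $I_s(P) = \emptyset$. Two lattice polytopes are unimodularly equivalent if there is an affine map $x\mapsto Ax+b$, $A\in GL_d(\mathbb{Z})$, $b\in\mathbb{Z}^d$, mapping one onto the other. A lattice projection is a surjective affine-linear map $\phi$ from $\mathbb{R}^d$ onto an $m$-dimensional real vector space whose kernel is affinely generated by lattice points (equivalently $\phi(\mathbb{Z}^d)$ is a lattice of rank $m$); identifying $\phi(\mathbb{Z}^d)$ with $\mathbb{Z}^m$, $\phi(P)$ is a lattice polytope in $\mathbb{R}^m$ and $s$-hollowness is taken with respect to this identification. Volume is measured with respect to $\mathbb{Z}^d$, normalized so that $[0,1]^d$ has volume $1$. *)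

theory Defs
  imports "HOL-Analysis.Analysis"
begin

definition int_lattice :: "(real^'n) set" where
  "int_lattice = {x. \<forall>i. x $ i \<in> \<int>}"

definition lattice_polytope :: "'a::real_vector set \<Rightarrow> 'a set \<Rightarrow> bool" where
  "lattice_polytope L P \<longleftrightarrow> (\<exists>S. finite S \<and> S \<subseteq> L \<and> P = convex hull S)"

(* V is the ambient real vector space (possibly a proper subspace of the type, possibly {0}) and
   L a full-rank lattice in it. The interior is the topological interior relative to V, so a
   point is its own interior in V = {0}. The definition does not change under a linear
   isomorphism V \<rightarrow> R^m carrying L to Z^m. *)
definition s_hollow :: "'a::real_normed_vector set \<Rightarrow> 'a set \<Rightarrow> nat \<Rightarrow> 'a set \<Rightarrow> bool" where
  "s_hollow V L s P \<longleftrightarrow> (top_of_set V interior_of P) \<inter> (\<lambda>x. real s *\<^sub>R x) ` L = {}"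

lemma s_hollow_UNIV:
  "s_hollow UNIV L s P \<longleftrightarrow> interior P \<inter> (\<lambda>x. real s *\<^sub>R x) ` L = {}"
  by (simp add: s_hollow_def)

(* invertible is invertibility over the integers here, i.e. A is in GL_n(Z) *)
definition unimodular_equiv :: "((real^'n) set \<times> (real^'n) set) set" where
  "unimodular_equiv =
     {(P, Q). \<exists>(A :: int^'n^'n) b. invertible A \<and> b \<in> int_lattice \<and>
        Q = (\<lambda>x. map_matrix real_of_int A *v x + b) ` P}"

(* The target space of dimension m \<le> n is taken to be a linear subspace V of R^n, which loses no
   generality and includes m = 0. The kernel condition makes \<phi> ` int_lattice a lattice in V
   that contains 0 and has full rank; this lattice plays the role of Z^m. *)
definition lattice_projection :: "(real^'n \<Rightarrow> real^'n) \<Rightarrow> (real^'n) set \<Rightarrow> bool" where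
  "lattice_projection \<phi> V \<longleftrightarrow>
     (\<exists>h c. linear h \<and> \<phi> = (\<lambda>x. h x + c)) \<and>
     subspace V \<and> range \<phi> = V \<and>
     \<phi> -` {0} = affine hull (\<phi> -` {0} \<inter> int_lattice)"

definition projects_to_s_hollow :: "nat \<Rightarrow> nat \<Rightarrow> (real^'n) set \<Rightarrow> bool" where
  "projects_to_s_hollow m s P \<longleftrightarrow>
     (\<exists>\<phi> V. lattice_projection \<phi> V \<and> dim V = m \<and>
        lattice_polytope (\<phi> ` int_lattice) (\<phi> ` P) \<and> aff_dim (\<phi> ` P) = int m \<and>
        s_hollow V (\<phi> ` int_lattice) s (\<phi> ` P))"

definition s_hollow_d_polytope :: "nat \<Rightarrow> (real^'n) set \<Rightarrow> bool" where
  "s_hollow_d_polytope s P \<longleftrightarrow>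
     lattice_polytope int_lattice P \<and> aff_dim P = int CARD('n) \<and> s_hollow UNIV int_lattice s P"

lemma map_matrix_of_int_mult:
  "map_matrix real_of_int (A ** B) = map_matrix real_of_int A ** map_matrix real_of_int B"
  by (simp add: vec_eq_iff matrix_matrix_mult_def)

lemma map_matrix_of_int_one: "map_matrix real_of_int (mat 1) = mat 1"
  by (simp add: vec_eq_iff mat_def)

lemma int_lattice_matrix:
  "b \<in> int_lattice \<Longrightarrow> map_matrix real_of_int A *v b \<in> int_lattice"
  by (auto simp: int_lattice_def matrix_vector_mult_def intro!: Ints_sum Ints_mult)

lemma equiv_unimodular_equiv: "equiv UNIV (unimodular_equiv :: ((real^'n) set \<times> (real^'n) set) set)"
proof (rule equivI)
  show "refl (unimodular_equiv :: ((real^'n) set \<times> (real^'n) set) set)"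
  proof (rule refl_onI)
    fix P :: "(real^'n) set"
    have "P = (\<lambda>x. map_matrix real_of_int (mat 1) *v x + 0) ` P"
      by (simp add: map_matrix_of_int_one)
    moreover have "invertible (mat 1 :: int^'n^'n)"
      unfolding invertible_def by (metis matrix_mul_lid)
    moreover have "(0 :: real^'n) \<in> int_lattice"
      by (simp add: int_lattice_def)
    ultimately show "(P, P) \<in> unimodular_equiv"
      unfolding unimodular_equiv_def by blast
  qed
  show "sym (unimodular_equiv :: ((real^'n) set \<times> (real^'n) set) set)"
  proof (rule symI)
    fix P Q :: "(real^'n) set"
    assume "(P, Q) \<in> unimodular_equiv"
    then obtain A :: "int^'n^'n" and b where A: "invertible A" and b: "b \<in> int_lattice"
      and Q: "Q = (\<lambda>x. map_matrix real_of_int A *v x + b) ` P"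
      unfolding unimodular_equiv_def by auto
    obtain B where B: "A ** B = mat 1" "B ** A = mat 1"
      using A unfolding invertible_def by auto
    let ?A = "map_matrix real_of_int A" and ?B = "map_matrix real_of_int B"
    have BA: "?B *v (?A *v x) = x" for x
      by (metis B(2) map_matrix_of_int_mult map_matrix_of_int_one matrix_vector_mul_assoc
          matrix_vector_mul_lid)
    have "P = (\<lambda>x. ?B *v x + - (?B *v b)) ` Q"
      unfolding Q image_image by (simp add: matrix_vector_right_distrib BA)
    moreover have "invertible B" using B unfolding invertible_def by auto
    moreover have "- (?B *v b) \<in> int_lattice"
      using int_lattice_matrix[OF b, of B] by (auto simp: int_lattice_def)
    ultimately show "(Q, P) \<in> unimodular_equiv"
      unfolding unimodular_equiv_def by blast
  qed
  show "trans (unimodular_equiv :: ((real^'n) set \<times> (real^'n) set) set)"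
  proof (rule transI)
    fix P Q R :: "(real^'n) set"
    assume "(P, Q) \<in> unimodular_equiv" "(Q, R) \<in> unimodular_equiv"
    then obtain A B :: "int^'n^'n" and a b where *: "invertible A" "invertible B"
      "a \<in> int_lattice" "b \<in> int_lattice"
      and Q: "Q = (\<lambda>x. map_matrix real_of_int A *v x + a) ` P"
      and R: "R = (\<lambda>x. map_matrix real_of_int B *v x + b) ` Q"
      unfolding unimodular_equiv_def by auto
    have "R = (\<lambda>x. map_matrix real_of_int (B ** A) *v x + (map_matrix real_of_int B *v a + b)) ` P"
      unfolding Q R image_image
      by (simp add: map_matrix_of_int_mult matrix_vector_right_distrib matrix_vector_mul_assoc
          add.assoc)
    moreover have "map_matrix real_of_int B *v a + b \<in> int_lattice"
      using int_lattice_matrix[OF *(3), of B] *(4) by (auto simp: int_lattice_def)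
    moreover have "invertible (B ** A)" using * by (simp add: invertible_mult)
    ultimately show "(P, R) \<in> unimodular_equiv"
      unfolding unimodular_equiv_def by blast
  qed
qed simp

end

theory Submission
  imports Defs
begin

text \<open>
  Suppose \<open>P\<close> has volume greater than \<open>(s R)^d\<close>, where \<open>R\<close> is the number in parentheses in the
  bound. By Blichfeldt's theorem \<open>P\<close> contains two points whose difference is \<open>r z\<close> with \<open>r > s R\<close>
  and \<open>z\<close> a nonzero lattice vector. Project along \<open>z\<close>. If the image \<open>Q\<close> is not \<open>s\<close>-hollow, then
  (Pikhurko) it has an interior point \<open>w\<close> of the \<open>s\<close>-fold lattice such that every \<open>x \<in> Q\<close>
  satisfies \<open>w = x / R + (1 - 1 / R) y\<close> for some \<open>y \<in> Q\<close>. Hence the fibre of \<open>P\<close> over \<open>w\<close> contains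
  a segment \<open>(r / R) z\<close> longer than \<open>s z\<close>, and so an interior point of the \<open>s\<close>-fold lattice.

  To find \<open>w\<close>, write an interior point of the \<open>s\<close>-fold lattice as a positive combination of at most
  \<open>2 d\<close> vertices, among them those of a simplex of maximal volume. Replacing the weights \<open>a\<close> by
  \<open>(1 + s q) a - s p\<close>, where \<open>p\<close> is integral with sum \<open>q\<close>, leads to another point of the \<open>s\<close>-fold
  lattice. If the smallest weight is tiny, Dirichlet approximation of the large weights yields
  \<open>p\<close> and \<open>q\<close> for which the smallest weight at least doubles.

  Finiteness: in the coordinates of a maximal lattice simplex of \<open>P\<close>, the vertices of \<open>P\<close> lie in
  \<open>[-1, 1]^d\<close> and the integer lattice becomes a superlattice of itself of bounded index.
\<close>

subsection \<open>Weights with dominated partial products\<close>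

text \<open>Abel summation: the weighted sum is \<open>g 0\<close> times the full sum of
  \<open>\<delta>\<close> plus the increments of \<open>g\<close> times the later tail sums. The
  induction runs downwards over the start \<open>j\<close> of the tail.\<close>

lemma sum_mono_weights_nonneg:
  fixes g \<delta> :: "nat \<Rightarrow> real"
  assumes "\<And>i. i < K \<Longrightarrow> 0 \<le> g i" "\<And>i. Suc i < K \<Longrightarrow> g i \<le> g (Suc i)"
    and tail: "\<And>j. j < K \<Longrightarrow> 0 \<le> sum \<delta> {j..<K}"
  shows "0 \<le> (\<Sum>i<K. g i * \<delta> i)"
proof (cases "K = 0")
  case False
  have "g j * sum \<delta> {j..<K} \<le> (\<Sum>i\<in>{j..<K}. g i * \<delta> i)" if "j \<le> K - 1" for j
    using that
  proof (induction rule: inc_induct)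
    case base
    then show ?case using False by (cases K) auto
  next
    case (step j)
    have split: "sum h {j..<K} = h j + sum h {Suc j..<K}" for h :: "nat \<Rightarrow> real"
      using step by (simp add: sum.atLeast_Suc_lessThan)
    have "g j * sum \<delta> {Suc j..<K} \<le> g (Suc j) * sum \<delta> {Suc j..<K}"
      using step assms by (intro mult_right_mono) auto
    then show ?case using step.IH by (simp add: split algebra_simps)
  qed
  from this[of 0] assms(1)[of 0] tail[of 0] False show ?thesis
    by (simp add: atLeast0LessThan) (meson mult_nonneg_nonneg order_trans)
qed simp

text \<open>Majorization for the concave logarithm, through its tangent line:
  \<open>b i / a i\<close> is at most \<open>exp (b i / a i - 1)\<close>, and the exponents have a
  nonpositive sum.\<close>

lemma prod_le_of_tail_sums:
  fixes a b :: "nat \<Rightarrow> real"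
  assumes pos: "\<And>i. i < K \<Longrightarrow> 0 < a i" "\<And>i. i < K \<Longrightarrow> 0 < b i"
    and decr: "\<And>i. Suc i < K \<Longrightarrow> a (Suc i) \<le> a i"
    and tail: "\<And>j. j < K \<Longrightarrow> sum b {j..<K} \<le> sum a {j..<K}"
  shows "prod b {..<K} \<le> prod a {..<K}"
proof -
  \<comment> \<open>The weights \<open>inverse (a i)\<close> are nondecreasing because
    \<open>a\<close> is nonincreasing, so Abel summation applies to
    \<open>a i - b i\<close>.\<close>
  have "0 \<le> (\<Sum>i<K. inverse (a i) * (a i - b i))"
    using pos decr tail
    by (intro sum_mono_weights_nonneg) (auto simp: sum_subtractf intro!: le_imp_inverse_le less_imp_le)
  also have "\<dots> = - (\<Sum>i<K. b i / a i - 1)"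
    unfolding sum_negf[symmetric] using pos(1)
    by (intro sum.cong refl) (force simp: field_simps)
  finally have S: "(\<Sum>i<K. b i / a i - 1) \<le> 0" by simp
  have "(\<Prod>i<K. b i / a i) \<le> (\<Prod>i<K. exp (b i / a i - 1))"
  proof (intro prod_mono conjI)
    fix i assume "i \<in> {..<K}"
    then show "0 \<le> b i / a i" using pos[of i] by simp
    show "b i / a i \<le> exp (b i / a i - 1)"
      using exp_ge_add_one_self[of "b i / a i - 1"] by linarith
  qed
  also have "\<dots> = exp (\<Sum>i<K. b i / a i - 1)" by (simp add: exp_sum)
  also have "\<dots> \<le> 1" using S by simp
  finally show ?thesis
    using prod_pos[of "{..<K}" a] pos(1) by (simp add: prod_dividef)
qed

text \<open>Tail sums of the extremal infinite weight sequence
  \<open>sylv c i - sylv c (Suc i)\<close>. The reciprocals obey x -> c x^2 + x; for c = 1 they are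
  1, 2, 6, 42, ..., Sylvester's numbers minus one.\<close>

primrec sylv :: "real \<Rightarrow> nat \<Rightarrow> real" where
  "sylv c 0 = 1"
| "sylv c (Suc k) = (sylv c k)\<^sup>2 / (c + sylv c k)"

lemma sylv_pos: "c > 0 \<Longrightarrow> sylv c k > 0"
  by (induction k) (auto simp: add_pos_pos)

lemma sylv_le_1: "c > 0 \<Longrightarrow> sylv c k \<le> 1"
proof (induction k)
  case (Suc k)
  then have "sylv c k > 0" by (simp add: sylv_pos)
  then have "(sylv c k)\<^sup>2 \<le> c + sylv c k"
    using Suc mult_left_le[of "sylv c k" "sylv c k"] unfolding power2_eq_square by linarith
  with Suc sylv_pos[of c k] show ?case by (simp add: divide_le_eq)
qed simp

text \<open>As \<open>c + sylv c k\<close> is at most \<open>c + 1\<close>, each step takes the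
  quotient u = \<open>sylv c k / (c + 1)\<close> to at least u^2, and u starts at
  \<open>1 / (c + 1)\<close>.\<close>

lemma sylv_lower: 
  assumes c: "c > 0" shows "1 / (c + 1) ^ (2 ^ k) \<le> sylv c k / (c + 1)"
proof (induction k)
  case (Suc k)
  have pos: "0 < sylv c k" using sylv_pos c by blast
  have "1 / (c + 1) ^ (2 ^ Suc k) = (1 / (c + 1) ^ (2 ^ k))\<^sup>2"
    by (simp add: power_divide power_mult[symmetric] mult.commute)
  also have "\<dots> \<le> (sylv c k / (c + 1))\<^sup>2" using Suc c by (intro power_mono) auto
  also have "\<dots> = (sylv c k)\<^sup>2 / (c + 1) / (c + 1)" by (simp add: power2_eq_square)
  also have "\<dots> \<le> (sylv c k)\<^sup>2 / (c + sylv c k) / (c + 1)"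
    using sylv_le_1[OF c, of k] pos c by (intro divide_right_mono divide_left_mono) auto
  finally show ?case by simp
qed simp

text \<open>Each factor equals \<open>sylv c (Suc i) / sylv c i\<close>, so the product
  telescopes.\<close>

lemma sylv_prod: "c > 0 \<Longrightarrow> sylv c k = (\<Prod>i<k. (sylv c i - sylv c (Suc i)) / c)"
proof (induction k)
  case (Suc k)
  have "c + sylv c k > 0" using Suc sylv_pos[of c k] by simp
  then have "sylv c (Suc k) = sylv c k * ((sylv c k - sylv c (Suc k)) / c)"
    using Suc.prems by (simp add: divide_simps power2_eq_square) algebra
  with Suc show ?case by simp
qed simp

text \<open>The differences \<open>b k = sylv c k - sylv c (Suc k)\<close> satisfy \<open>gap\<close> with equality. At the first \<open>k\<close>
  violating the claim, the tail sums of \<open>a\<close> below \<open>k\<close> dominate those of \<open>b\<close>, so majorization for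
  the convex function \<open>- ln\<close> contradicts \<open>gap\<close>.\<close>

lemma tail_sums_ge_sylv:
  fixes a :: "nat \<Rightarrow> real"
  assumes c: "c > 0" and pos: "\<And>i. i < n \<Longrightarrow> 0 < a i"
    and decr: "\<And>i. Suc i < n \<Longrightarrow> a (Suc i) \<le> a i"
    and sum1: "sum a {..<n} = 1"
    and gap: "\<And>k. k < n \<Longrightarrow> (\<Prod>i<k. a i / c) \<le> sum a {k..<n}"
  shows "k < n \<Longrightarrow> sylv c k \<le> sum a {k..<n}"
proof (induction k rule: less_induct)
  case (less k)
  define b where "b i = sylv c i - sylv c (Suc i)" for i
  have bpos: "b i > 0" for i
  proof -
    have "c + sylv c i > 0" using c sylv_pos[of c i] by simp
    then have "b i = c * sylv c i / (c + sylv c i)"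
      by (simp add: b_def field_simps power2_eq_square)
    then show ?thesis using c sylv_pos[of c i] by (simp add: add_pos_pos)
  qed
  show ?case
  proof (rule ccontr)
    assume neg: "\<not> ?thesis"
    have "prod b {..<k} \<le> prod a {..<k}"
    proof (rule prod_le_of_tail_sums)
      fix j assume j: "j < k"
      have "sum b {j..<k} = sylv c j - sylv c k"
        unfolding b_def using j sum_natinterval_diff[of "sylv c" j "k-1"]
        by (cases k) (auto simp: atLeastLessThanSuc_atLeastAtMost)
      moreover have "sum a {j..<n} = sum a {j..<k} + sum a {k..<n}"
        using j less.prems by (simp add: sum.atLeastLessThan_concat)
      moreover have "sylv c j \<le> sum a {j..<n}" using less j by auto
      ultimately show "sum b {j..<k} \<le> sum a {j..<k}" using neg by linarith
    qed (use less.prems pos bpos decr in auto)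
    then have "(\<Prod>i<k. b i / c) \<le> (\<Prod>i<k. a i / c)"
      using c by (simp add: prod_dividef divide_right_mono)
    with gap[OF less.prems] neg sylv_prod[OF c, of k] show False by (simp add: b_def)
  qed
qed

section \<open>Simultaneous Dirichlet approximation\<close>

text \<open>Pigeonhole with a separate precision for each coordinate: as \<open>q\<close> runs from
  0 to the product of the \<open>N i\<close>, the fractional parts of \<open>q * x i\<close> fall
  into only that many boxes. The difference of two values of \<open>q\<close> sharing a box
  works.\<close>

lemma dirichlet_boxes:
  fixes x :: "nat \<Rightarrow> real" and N :: "nat \<Rightarrow> nat"
  assumes N: "\<And>i. i < k \<Longrightarrow> N i > 0"
  obtains q :: nat and p :: "nat \<Rightarrow> int" where "0 < q" "q \<le> (\<Prod>i<k. N i)"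
    "\<And>i. i < k \<Longrightarrow> \<bar>real q * x i - p i\<bar> < 1 / N i"
proof -
  define box where
    "box q = restrict (\<lambda>i. nat \<lfloor>real (N i) * frac (real q * x i)\<rfloor>) {..<k}" for q :: nat
  have "box ` {..\<Prod>i<k. N i} \<subseteq> (\<Pi>\<^sub>E i\<in>{..<k}. {..<N i})"
  proof (intro image_subsetI PiE_I)
    fix q i assume "i \<in> {..<k}"
    moreover from this have "real (N i) * frac (real q * x i) < real (N i)"
      using N[of i] frac_lt_1 by simp
    ultimately show "box q i \<in> {..<N i}"
      using N[of i] by (simp add: box_def nat_less_iff floor_less_iff)
  qed (simp add: box_def)
  then have "card (box ` {..\<Prod>i<k. N i}) \<le> (\<Prod>i<k. N i)"
    using card_mono[of "\<Pi>\<^sub>E i\<in>{..<k}. {..<N i}"] by (simp add: card_PiE finite_PiE)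
  then have "\<not> inj_on box {..\<Prod>i<k. N i}"
    by (metis card_atMost card_image not_less_eq_eq order_refl)
  then obtain q1 q2 where q: "box q1 = box q2" "q1 < q2" "q2 \<le> (\<Prod>i<k. N i)"
    unfolding inj_on_def by (metis atMost_iff linorder_neqE_nat)
  show ?thesis
  proof (rule that[of "q2 - q1" "\<lambda>i. \<lfloor>real q2 * x i\<rfloor> - \<lfloor>real q1 * x i\<rfloor>"])
    fix i assume i: "i < k"
    let ?f = "\<lambda>q. real (N i) * frac (real q * x i)"
    have "nat \<lfloor>?f q1\<rfloor> = nat \<lfloor>?f q2\<rfloor>"
      using fun_cong[OF q(1), of i] i by (simp add: box_def)
    then have "\<lfloor>?f q1\<rfloor> = \<lfloor>?f q2\<rfloor>" using eq_nat_nat_iff by force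
    then have "\<bar>?f q2 - ?f q1\<bar> < 1" by linarith
    then have "real (N i) * \<bar>frac (real q2 * x i) - frac (real q1 * x i)\<bar> < 1"
      by (metis abs_mult abs_of_nat right_diff_distrib)
    then have "\<bar>frac (real q2 * x i) - frac (real q1 * x i)\<bar> < 1 / N i"
      using N[OF i] by (simp add: pos_less_divide_eq mult.commute)
    moreover have "real (q2 - q1) * x i - (\<lfloor>real q2 * x i\<rfloor> - \<lfloor>real q1 * x i\<rfloor>)
        = frac (real q2 * x i) - frac (real q1 * x i)"
      using q(2) by (simp add: frac_def of_nat_diff algebra_simps)
    ultimately show "\<bar>real (q2 - q1) * x i - of_int (\<lfloor>real q2 * x i\<rfloor> - \<lfloor>real q1 * x i\<rfloor>)\<bar> < 1 / N i"
      by simp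
  qed (use q in auto)
qed

text \<open>The gap separates the large weights, before position \<open>k\<close>, from the tail.
  Approximating the large weights costs each at most half of its value, which leaves at least twice
  the least weight; the tail weights are multiplied by \<open>1 + s * q\<close>, which is at least
  2.\<close>

lemma gap_step:
  fixes a :: "nat \<Rightarrow> real" and s :: nat
  assumes s: "s \<ge> 1" and pos: "\<And>i. i < n \<Longrightarrow> 0 < a i"
    and decr: "\<And>i j. i \<le> j \<Longrightarrow> j < n \<Longrightarrow> a j \<le> a i"
    and sum1: "sum a {..<n} = 1" and k: "k < n"
    and gap: "sum a {k..<n} < (\<Prod>i<k. a i / (4 * real s + 2))"
  obtains q :: nat and p :: "nat \<Rightarrow> int" where "sum p {..<n} = int q"
    "\<And>i. i < n \<Longrightarrow> 2 * a (n - 1) \<le> (1 + real s * q) * a i - real s * p i"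
proof -
  have k0: "k > 0" using gap sum1 k by (cases k) (auto simp: atLeast0LessThan)
  have le1: "a i \<le> 1" if "i < n" for i
    using member_le_sum[of i "{..<n}" a] that pos sum1 by (force simp: less_imp_le)
  \<comment> \<open>The least integer making the error \<open>1 / N i\<close> at most
    \<open>a i / (2 * s)\<close>. As \<open>a i\<close> is at most 1, rounding up still leaves
    \<open>a i * N i\<close> at most \<open>2 * s + 1\<close>.\<close>
  define N where "N i = nat \<lceil>2 * real s / a i\<rceil>" for i
  have N: "2 * real s / a i \<le> N i" "N i \<le> (2 * real s + 1) / a i" "N i > 0" if "i < k" for i
  proof -
    have i: "0 < a i" "a i \<le> 1" using that k pos le1 by auto
    then have p: "2 * real s / a i > 0" using s by simp
    show "2 * real s / a i \<le> N i" unfolding N_def by linarith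
    have "N i \<le> 2 * real s / a i + 1" unfolding N_def using p by linarith
    also have "\<dots> \<le> (2 * real s + 1) / a i" using i by (simp add: field_simps)
    finally show "N i \<le> (2 * real s + 1) / a i" .
    show "N i > 0" unfolding N_def using p by simp
  qed
  obtain q p where q: "0 < q" "q \<le> (\<Prod>i<k. N i)"
    and p: "\<And>i. i < k \<Longrightarrow> \<bar>real q * a i - of_int (p i)\<bar> < 1 / N i"
    using dirichlet_boxes[of k N a] N(3) by blast
  have p': "\<bar>real q * a i - of_int (p i)\<bar> \<le> a i / (2 * s)" if "i < k" for i
  proof -
    have "0 < a i" using that k pos by auto
    then have "1 / N i \<le> 1 / (2 * real s / a i)"
      using N[OF that] s by (intro divide_left_mono) auto
    then show ?thesis using p[OF that] by simp
  qed
  have tailpos: "sum a {k..<n} > 0" using k pos by (intro sum_pos) auto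
  \<comment> \<open>The origin of \<open>4 * s + 2\<close>: each factor is at most
    \<open>(2 * s + 1) / (4 * s + 2)\<close>, that is 1/2, and by \<open>k0\<close> there is at
    least one factor.\<close>
  have half: "(\<Prod>i<k. a i / (4 * real s + 2)) * (\<Prod>i<k. real (N i)) \<le> 1 / 2"
  proof -
    have "(\<Prod>i<k. a i / (4 * real s + 2)) * (\<Prod>i<k. real (N i))
        = (\<Prod>i<k. a i / (4 * real s + 2) * real (N i))" by (rule prod.distrib[symmetric])
    also have "\<dots> \<le> (\<Prod>i<k. 1 / 2)"
    proof (intro prod_mono conjI)
      fix i assume "i \<in> {..<k}"
      then have i: "i < k" "0 < a i" using k pos by auto
      then show "0 \<le> a i / (4 * real s + 2) * real (N i)" by simp
      have "a i * real (N i) \<le> 2 * real s + 1" using N(2)[OF i(1)] i by (simp add: field_simps)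
      then show "a i / (4 * real s + 2) * real (N i) \<le> 1 / 2" by (simp add: field_simps)
    qed
    also have "\<dots> \<le> 1 / 2" using k0 power_decreasing[of 1 k "1/2::real"] by simp
    finally show ?thesis .
  qed
  have Npos: "(\<Prod>i<k. real (N i)) > 0" using N(3) by (intro prod_pos) auto
  have qtail: "real q * sum a {k..<n} < 1 / 2"
  proof -
    have "real q \<le> (\<Prod>i<k. real (N i))" using q(2) by (metis of_nat_le_iff of_nat_prod)
    then have "real q * sum a {k..<n} \<le> (\<Prod>i<k. real (N i)) * sum a {k..<n}"
      using tailpos by simp
    also have "\<dots> < (\<Prod>i<k. real (N i)) * (\<Prod>i<k. a i / (4 * real s + 2))"
      using gap Npos by simp
    finally show ?thesis using half by (simp add: mult.commute)
  qed
  have split: "sum h {..<n} = sum h {..<k} + sum h {k..<n}" for h :: "nat \<Rightarrow> 'b::comm_monoid_add"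
    using k by (simp add: sum.atLeastLessThan_concat flip: atLeast0LessThan)
  \<comment> \<open>The rounding errors total at most 1/2 and the omitted tail accounts for less
    than 1/2 of \<open>q\<close>, so two integers less than 1 apart must agree.\<close>
  have sump: "sum p {..<k} = int q"
  proof -
    have "\<bar>\<Sum>i<k. real q * a i - p i\<bar> \<le> (\<Sum>i<k. a i / (2 * s))"
      using p' by (intro order_trans[OF sum_abs] sum_mono) auto
    also have "\<dots> = sum a {..<k} / (2 * s)" by (simp add: sum_divide_distrib)
    also have "\<dots> \<le> 1 / 2" using s sum1 tailpos split[of a] by (simp add: field_simps)
    finally have "\<bar>real q * sum a {..<k} - sum p {..<k}\<bar> \<le> 1 / 2"
      by (simp add: sum_subtractf sum_distrib_left)
    moreover have "real q * sum a {..<k} = real q - real q * sum a {k..<n}"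
      using split[of a] sum1 by (simp add: algebra_simps flip: distrib_left)
    moreover have "0 < real q * sum a {k..<n}" using q(1) tailpos by simp
    ultimately have "\<bar>real q - of_int (sum p {..<k})\<bar> < 1" using qtail by linarith
    then show ?thesis by linarith
  qed
  \<comment> \<open>Taking 0 on the tail keeps the sum at \<open>q\<close> and leaves the tail
    weights merely scaled.\<close>
  show ?thesis
  proof (rule that[of "\<lambda>i. if i < k then p i else 0" q])
    show "(\<Sum>i<n. if i < k then p i else 0) = int q"
      using sump by (simp add: split)
    fix i assume i: "i < n"
    have last: "0 < a (n - 1)" "a (n - 1) \<le> a i" using i pos decr[of i "n-1"] by auto
    show "2 * a (n - 1) \<le> (1 + real s * q) * a i - real s * (if i < k then p i else 0)"
    proof (cases "i < k")
      case True
      have ai: "0 < a i" using i pos by simp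
      have "a (n - 1) \<le> sum a {k..<n}"
        using k pos by (intro member_le_sum) (auto simp: less_imp_le)
      also have "\<dots> < (\<Prod>i<k. a i / (4 * real s + 2))" by (rule gap)
      also have "\<dots> \<le> a i / (4 * real s + 2)"
      proof -
        have "(\<Prod>j\<in>{..<k}-{i}. a j / (4 * real s + 2)) \<le> 1"
        proof (intro prod_le_1 conjI)
          fix j assume "j \<in> {..<k} - {i}"
          then have "0 < a j" "a j \<le> 1" using pos le1 k by auto
          then show "0 \<le> a j / (4 * real s + 2)" "a j / (4 * real s + 2) \<le> 1" by auto
        qed
        then show ?thesis using True ai mult_left_le[of _ "a i / (4 * real s + 2)"]
          by (subst prod.remove[of _ i]) auto
      qed
      also have "\<dots> \<le> a i / 4" using ai s by (intro divide_left_mono) auto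
      finally have 1: "2 * a (n - 1) \<le> a i / 2" by simp
      have "real s * \<bar>real q * a i - of_int (p i)\<bar> \<le> real s * (a i / (2 * s))"
        using p'[OF True] by (intro mult_left_mono) auto
      also have "\<dots> = a i / 2" using s by simp
      finally have "real s * \<bar>real q * a i - of_int (p i)\<bar> \<le> a i / 2" .
      moreover have "real s * (of_int (p i) - real q * a i) \<le> real s * \<bar>real q * a i - of_int (p i)\<bar>"
        by (intro mult_left_mono) auto
      ultimately show ?thesis using 1 True by (simp add: algebra_simps)
    next
      case False
      have "1 * 1 \<le> real s * real q" using s q(1) by (intro mult_mono) auto
      then have "2 * a i \<le> (1 + real s * q) * a i" using last by (intro mult_right_mono) auto
      with last have "2 * a (n - 1) \<le> (1 + real s * q) * a i" by linarith
      then show ?thesis using False by simp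
    qed
  qed
qed

section \<open>Doubling the smallest weight\<close>

lemma obtain_decreasing_enum:
  fixes a :: "'a \<Rightarrow> real"
  assumes "finite U"
  obtains h where "bij_betw h {..<card U} U"
    "\<And>i j. i \<le> j \<Longrightarrow> j < card U \<Longrightarrow> a (h j) \<le> a (h i)"
proof -
  obtain xs where xs: "set xs = U" "distinct xs" using finite_distinct_list assms by blast
  define ys where "ys = sort_key (\<lambda>u. - a u) xs"
  have ys: "set ys = U" "distinct ys" "length ys = card U" "sorted (map (\<lambda>u. - a u) ys)"
    using xs by (auto simp: ys_def distinct_card)
  show ?thesis
  proof (rule that[of "(!) ys"])
    show "bij_betw ((!) ys) {..<card U} U" using ys by (metis bij_betw_nth)
    show "a (ys ! j) \<le> a (ys ! i)" if "i \<le> j" "j < card U" for i j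
      using sorted_nth_mono[OF ys(4) that(1)] that ys(3) by simp
  qed
qed

text \<open>Without a gap, \<open>tail_sums_ge_sylv\<close> at the last position bounds the least
  weight below by a value of \<open>sylv\<close> with \<open>c = 4 * s + 2\<close>, against
  \<open>small\<close>. The lower bound \<open>m\<close> is arbitrary so that the doubling can be
  iterated.\<close>

lemma double_small_weights:
  fixes a :: "'a \<Rightarrow> real" and s :: nat
  assumes s: "s \<ge> 1" and U: "finite U" and pos: "\<And>u. u \<in> U \<Longrightarrow> 0 < a u"
    and sum1: "sum a U = 1" and m: "\<And>u. u \<in> U \<Longrightarrow> m \<le> a u"
    and small: "u0 \<in> U" "a u0 < 1 / (4 * real s + 3) ^ (2 ^ (card U - 1))"
  obtains q :: nat and p :: "'a \<Rightarrow> int" where "sum p U = int q"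
    "\<And>u. u \<in> U \<Longrightarrow> 2 * m \<le> (1 + real s * q) * a u - real s * p u"
proof -
  define n where "n = card U"
  have n: "n > 0" using small(1) U by (auto simp: n_def card_gt_0_iff)
  obtain h where h: "bij_betw h {..<n} U"
    and decr: "\<And>i j. i \<le> j \<Longrightarrow> j < n \<Longrightarrow> a (h j) \<le> a (h i)"
    using obtain_decreasing_enum[OF U, of a] unfolding n_def by blast
  have hU: "h i \<in> U" if "i < n" for i using h that by (auto simp: bij_betw_def)
  have surj: "\<exists>i<n. u = h i" if "u \<in> U" for u using h that by (auto simp: bij_betw_def)
  have sum1': "(\<Sum>i<n. a (h i)) = 1" using sum.reindex_bij_betw[OF h, of a] sum1 by simp
  let ?c = "4 * real s + 2"
  have "\<exists>k<n. (\<Sum>i=k..<n. a (h i)) < (\<Prod>i<k. a (h i) / ?c)"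
  proof (rule ccontr)
    assume "\<not> ?thesis"
    then have "sylv ?c (n - 1) \<le> (\<Sum>i=n-1..<n. a (h i))"
      using tail_sums_ge_sylv[of ?c n "\<lambda>i. a (h i)" "n - 1"] pos hU decr sum1' n by force
    also have "{n-1..<n} = {n - 1}" using n by auto
    finally have "sylv ?c (n - 1) \<le> a (h (n - 1))" by simp
    also have "\<dots> \<le> a u0" using surj[OF small(1)] decr n by force
    finally have "sylv ?c (n - 1) < 1 / (4 * real s + 3) ^ (2 ^ (n - 1))"
      using small(2) unfolding n_def by linarith
    also have "4 * real s + 3 = ?c + 1" by simp
    finally have "sylv ?c (n - 1) < 1 / (?c + 1) ^ (2 ^ (n - 1))" .
    moreover have "1 / (?c + 1) ^ (2 ^ (n - 1)) \<le> sylv ?c (n - 1) / (?c + 1)"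
      by (rule sylv_lower) simp
    moreover have "sylv ?c (n - 1) / (?c + 1) \<le> sylv ?c (n - 1)"
      using sylv_pos[of ?c "n - 1"] by (simp add: divide_le_eq)
    ultimately show False by linarith
  qed
  then obtain k where k: "k < n" "(\<Sum>i=k..<n. a (h i)) < (\<Prod>i<k. a (h i) / ?c)" by blast
  obtain q :: nat and p :: "nat \<Rightarrow> int" where p: "sum p {..<n} = int q"
    "\<And>i. i < n \<Longrightarrow> 2 * a (h (n - 1)) \<le> (1 + real s * q) * a (h i) - real s * p i"
    using gap_step[OF s, of n "\<lambda>i. a (h i)" k] pos hU decr sum1' k by metis
  define g where "g = inv_into {..<n} h"
  have gh: "g (h i) = i" if "i < n" for i
    using h that by (auto simp: g_def bij_betw_def)
  show ?thesis
  proof (rule that[of "\<lambda>u. p (g u)" q])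
    show "(\<Sum>u\<in>U. p (g u)) = int q"
      using sum.reindex_bij_betw[OF h, of "\<lambda>u. p (g u)"] p(1) gh by simp
    fix u assume "u \<in> U"
    then obtain i where i: "i < n" "u = h i" using surj by blast
    have "m \<le> a (h (n - 1))" using m hU n by simp
    then show "2 * m \<le> (1 + real s * q) * a u - real s * p (g u)"
      using p(2)[OF i(1)] i gh by simp
  qed
qed

text \<open>If every member of \<open>W\<close> had a weight below the threshold, the common lower
  bound could be doubled for ever, although positive weights of sum 1 never exceed 1. The assumption
  \<open>closed\<close> abstracts the passage to another point of the s-fold lattice.\<close>

lemma exists_large_weights:
  fixes W :: "('a \<Rightarrow> real) set" and s :: nat
  assumes s: "s \<ge> 1" and U: "finite U" "U \<noteq> {}" and a0: "a0 \<in> W"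
    and pos: "\<And>a u. a \<in> W \<Longrightarrow> u \<in> U \<Longrightarrow> 0 < a u" and sum1: "\<And>a. a \<in> W \<Longrightarrow> sum a U = 1"
    and closed: "\<And>a q p. a \<in> W \<Longrightarrow> sum p U = int q \<Longrightarrow>
      (\<And>u. u \<in> U \<Longrightarrow> 0 < (1 + real s * q) * a u - real s * of_int (p u)) \<Longrightarrow>
      (\<lambda>u. (1 + real s * q) * a u - real s * of_int (p u)) \<in> W"
  shows "\<exists>a\<in>W. \<forall>u\<in>U. 1 / (4 * real s + 3) ^ (2 ^ (card U - 1)) \<le> a u"
proof (rule ccontr)
  assume neg: "\<not> ?thesis"
  define m where "m = Min (a0 ` U)"
  have m: "0 < m" "\<And>u. u \<in> U \<Longrightarrow> m \<le> a0 u" using U pos[OF a0] by (auto simp: m_def)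
  have "\<exists>a\<in>W. \<forall>u\<in>U. 2 ^ j * m \<le> a u" for j :: nat
  proof (induction j)
    case 0
    then show ?case using a0 m by auto
  next
    case (Suc j)
    then obtain a where a: "a \<in> W" "\<And>u. u \<in> U \<Longrightarrow> 2 ^ j * m \<le> a u" by blast
    obtain u0 where u0: "u0 \<in> U" "a u0 < 1 / (4 * real s + 3) ^ (2 ^ (card U - 1))"
      using neg a(1) by force
    obtain q :: nat and p :: "'a \<Rightarrow> int" where p: "sum p U = int q"
      and le: "\<And>u. u \<in> U \<Longrightarrow> 2 * (2 ^ j * m) \<le> (1 + real s * q) * a u - real s * p u"
      using double_small_weights[OF s U(1) pos[OF a(1)] sum1[OF a(1)] a(2) u0] by blast
    have "0 < (1 + real s * q) * a u - real s * p u" if "u \<in> U" for u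
      using le[OF that] m(1) by (smt (verit) mult_pos_pos zero_less_power)
    from closed[OF a(1) p this] show ?case
      by (intro bexI) (use le in \<open>auto simp: mult.assoc\<close>)
  qed
  moreover obtain j :: nat where "1 / m < 2 ^ j" using real_arch_pow[of 2 "1 / m"] by auto
  ultimately obtain a where a: "a \<in> W" "\<And>u. u \<in> U \<Longrightarrow> 2 ^ j * m \<le> a u" by blast
  have "1 < 2 ^ j * m" using \<open>1 / m < 2 ^ j\<close> m(1) by (simp add: divide_less_eq)
  moreover obtain u where "u \<in> U" using U by blast
  moreover have "a u \<le> 1"
    using member_le_sum[of u U a] \<open>u \<in> U\<close> U pos[OF a(1)] sum1[OF a(1)] by (force simp: less_imp_le)
  ultimately show False using a(2)[of u] by linarith
qed

subsection \<open>Maximal simplices\<close>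

text \<open>The tuple \<open>f\<close> maximizes the absolute determinant among all tuples from
  \<open>S\<close>. By Cramer's rule the coefficient of \<open>x\<close> at \<open>f k\<close> is
  the quotient of two determinants, the upper one with column \<open>k\<close> replaced by
  \<open>x\<close>, so maximality bounds it by 1.\<close>

lemma exists_max_det_subset:
  fixes S :: "(real^'n) set"
  assumes S: "finite S" "span S = UNIV"
  obtains f :: "'n \<Rightarrow> real^'n" where "range f \<subseteq> S" "inj f" "det (\<chi> i j. f j $ i) \<noteq> 0"
    "\<And>x. x \<in> S \<Longrightarrow> \<exists>\<beta>. (\<forall>j. \<bar>\<beta> j\<bar> \<le> 1) \<and> x = (\<Sum>j\<in>UNIV. \<beta> j *\<^sub>R f j)"
proof -
  define D where "D f = \<bar>det (\<chi> i j. f j $ i)\<bar>" for f :: "'n \<Rightarrow> real^'n"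
  define F where "F = {f :: 'n \<Rightarrow> real^'n. range f \<subseteq> S}"
  obtain B where B: "B \<subseteq> S" "independent B" "S \<subseteq> span B"
    using maximal_independent_subset by blast
  have spanB: "span B = UNIV" using B S by (metis span_mono span_span top.extremum_uniqueI)
  have "card B = CARD('n)" "finite B"
    using B(2) spanB basis_card_eq_dim[of B UNIV] independent_imp_finite by auto
  then obtain g :: "'n \<Rightarrow> real^'n" where g: "bij_betw g UNIV B"
    by (metis finite_class.finite_UNIV finite_same_card_bij)
  have "columns (\<chi> i j. g j $ i) = B"
    using g by (auto simp: columns_def column_def bij_betw_def)
  then have "\<exists>M. (\<chi> i j. g j $ i) ** M = mat 1"
    using spanB by (simp add: matrix_right_invertible_span_columns span_vec_eq)
  then have "invertible (\<chi> i j. g j $ i)"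
    by (metis invertible_def matrix_left_right_inverse)
  then have Dg: "D g > 0" by (simp add: D_def invertible_det_nz)
  have gF: "g \<in> F" using g B by (auto simp: F_def bij_betw_def)
  have "F = (\<Pi>\<^sub>E i\<in>UNIV. S)" by (auto simp: F_def)
  then have finF: "finite F" using S by (simp add: finite_PiE)
  then have "Max (D ` F) \<in> D ` F" using gF by (intro Max_in) auto
  then obtain f where f: "f \<in> F" "D f = Max (D ` F)" by auto
  have max: "D h \<le> D f" if "h \<in> F" for h using f finF that by simp
  let ?A = "(\<chi> i j. f j $ i) :: real^'n^'n"
  have nz: "det ?A \<noteq> 0" using max[OF gF] Dg by (auto simp: D_def)
  show ?thesis
  proof (rule that[of f])
    show "range f \<subseteq> S" using f by (simp add: F_def)
    show "det ?A \<noteq> 0" by (rule nz)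
    show "inj f"
    proof (rule injI, rule ccontr)
      fix i j assume "f i = f j" "i \<noteq> j"
      then have "det ?A = 0" by (intro det_identical_columns[of i j]) (auto simp: column_def)
      with nz show False by simp
    qed
    fix x assume x: "x \<in> S"
    obtain M where "?A ** M = mat 1" using nz by (metis invertible_det_nz invertible_def)
    then have Ab: "?A *v (M *v x) = x" by (simp add: matrix_vector_mul_assoc)
    define b where "b = M *v x"
    note Ab = Ab[folded b_def]
    show "\<exists>\<beta>. (\<forall>j. \<bar>\<beta> j\<bar> \<le> 1) \<and> x = (\<Sum>j\<in>UNIV. \<beta> j *\<^sub>R f j)"
    proof (intro exI[of _ "\<lambda>j. b $ j"] conjI allI)
      show "x = (\<Sum>j\<in>UNIV. b $ j *\<^sub>R f j)"
        by (subst Ab[symmetric]) (simp add: vec_eq_iff matrix_vector_mult_def mult.commute)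
      fix k
      have "\<bar>b $ k * det ?A\<bar> = D (f(k := x))"
        unfolding cramer_lemma[symmetric] Ab D_def by (intro arg_cong[of _ _ "\<lambda>A. \<bar>det A\<bar>"]) (auto simp: vec_eq_iff)
      also have "\<dots> \<le> D f" using x f(1) by (intro max) (auto simp: F_def)
      finally show "\<bar>b $ k\<bar> \<le> 1" using nz by (simp add: D_def abs_mult)
    qed
  qed
qed

section \<open>Additive subgroups and lattice points with balanced weights\<close>

definition add_subgroup :: "'a::real_vector set \<Rightarrow> bool" where
  "add_subgroup L \<longleftrightarrow> 0 \<in> L \<and> (\<forall>x\<in>L. \<forall>y\<in>L. x - y \<in> L)"

lemma add_subgroup_closed:
  assumes "add_subgroup L"
  shows "0 \<in> L" "x \<in> L \<Longrightarrow> y \<in> L \<Longrightarrow> x - y \<in> L" "x \<in> L \<Longrightarrow> - x \<in> L"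
    "x \<in> L \<Longrightarrow> y \<in> L \<Longrightarrow> x + y \<in> L"
proof -
  show 1: "0 \<in> L" "x \<in> L \<Longrightarrow> y \<in> L \<Longrightarrow> x - y \<in> L" for x y
    using assms by (auto simp: add_subgroup_def)
  show 2: "x \<in> L \<Longrightarrow> - x \<in> L" for x using 1(2)[OF 1(1)] by simp
  show "x \<in> L \<Longrightarrow> y \<in> L \<Longrightarrow> x + y \<in> L" using 1(2)[of x "- y"] 2 by simp
qed

lemma add_subgroup_of_int:
  assumes L: "add_subgroup L" and x: "x \<in> L"
  shows "real_of_int k *\<^sub>R x \<in> L"
proof -
  have nat: "real n *\<^sub>R x \<in> L" for n :: nat
    by (induction n) (auto simp: add_subgroup_closed[OF L] x scaleR_add_left)
  show ?thesis
  proof (cases k)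
    case (nonneg n)
    then show ?thesis using nat by simp
  next
    case (neg n)
    then show ?thesis using add_subgroup_closed(3)[OF L nat[of "Suc n"]] by (simp flip: scaleR_minus_left)
  qed
qed

lemma add_subgroup_sum:
  "add_subgroup L \<Longrightarrow> (\<And>i. i \<in> I \<Longrightarrow> f i \<in> L) \<Longrightarrow> sum f I \<in> L"
  by (induction I rule: infinite_finite_induct) (auto simp: add_subgroup_closed)

text \<open>Changing the weights turns \<open>w\<close> into \<open>(1 + s * q) w\<close> minus the
  sum of the \<open>p u\<close> multiples of \<open>u\<close>, again a point of \<open>L\<close>,
  and keeps the total at \<open>(1 + s * q) - s * q = 1\<close>. So the positive weights
  representing points of the s-fold lattice meet the closure assumption of
  \<open>exists_large_weights\<close>.\<close>

lemma exists_balanced_lattice_point: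
  fixes U L :: "'a::real_vector set" and s :: nat
  assumes s: "s \<ge> 1" and L: "add_subgroup L" and U: "finite U" "U \<noteq> {}" "U \<subseteq> L"
    and pos: "\<And>u. u \<in> U \<Longrightarrow> 0 < a0 u" and sum1: "sum a0 U = 1"
    and w0: "w0 \<in> L" "(\<Sum>u\<in>U. a0 u *\<^sub>R u) = real s *\<^sub>R w0"
  shows "\<exists>a. \<exists>w\<in>L. (\<Sum>u\<in>U. a u *\<^sub>R u) = real s *\<^sub>R w \<and> sum a U = 1 \<and>
    (\<forall>u\<in>U. 1 / (4 * real s + 3) ^ (2 ^ (card U - 1)) \<le> a u)"
proof -
  define W where "W = {a. (\<forall>u\<in>U. 0 < a u) \<and> sum a U = 1 \<and>
     (\<exists>w\<in>L. (\<Sum>u\<in>U. a u *\<^sub>R u) = real s *\<^sub>R w)}"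
  have "\<exists>a\<in>W. \<forall>u\<in>U. 1 / (4 * real s + 3) ^ (2 ^ (card U - 1)) \<le> a u"
  proof (rule exists_large_weights[OF s U(1,2)])
    show "a0 \<in> W" using pos sum1 w0 by (auto simp: W_def)
    fix a q and p :: "'a \<Rightarrow> int"
    assume a: "a \<in> W" and p: "sum p U = int q"
      and pos: "\<And>u. u \<in> U \<Longrightarrow> 0 < (1 + real s * q) * a u - real s * of_int (p u)"
    from a obtain w where w: "w \<in> L" "(\<Sum>u\<in>U. a u *\<^sub>R u) = real s *\<^sub>R w" and a1: "sum a U = 1"
      by (auto simp: W_def)
    let ?w = "real_of_int (1 + int s * int q) *\<^sub>R w - (\<Sum>u\<in>U. real_of_int (p u) *\<^sub>R u)"
    have "?w \<in> L"
      using w(1) U by (intro add_subgroup_closed(2)[OF L] add_subgroup_sum[OF L] add_subgroup_of_int[OF L]) auto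
    moreover have "(\<Sum>u\<in>U. ((1 + real s * q) * a u - real s * of_int (p u)) *\<^sub>R u) = real s *\<^sub>R ?w"
    proof -
      have "(\<Sum>u\<in>U. ((1 + real s * q) * a u - real s * of_int (p u)) *\<^sub>R u)
        = (1 + real s * q) *\<^sub>R (\<Sum>u\<in>U. a u *\<^sub>R u) - real s *\<^sub>R (\<Sum>u\<in>U. real_of_int (p u) *\<^sub>R u)"
        by (simp add: scaleR_diff_left sum_subtractf scaleR_sum_right)
      then show ?thesis by (simp add: w algebra_simps)
    qed
    moreover have "(\<Sum>u\<in>U. (1 + real s * q) * a u - real s * of_int (p u)) = 1"
    proof -
      have "(\<Sum>u\<in>U. real_of_int (p u)) = real q" using p by (metis of_int_of_nat_eq of_int_sum)
      then show ?thesis by (simp add: sum_subtractf a1 flip: sum_distrib_left)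
    qed
    ultimately show "(\<lambda>u. (1 + real s * q) * a u - real s * of_int (p u)) \<in> W"
      using pos unfolding W_def by blast
  qed (auto simp: W_def)
  then obtain a where a: "a \<in> W" "\<forall>u\<in>U. 1 / (4 * real s + 3) ^ (2 ^ (card U - 1)) \<le> a u" ..
  from a(1) obtain w where "w \<in> L" "(\<Sum>u\<in>U. a u *\<^sub>R u) = real s *\<^sub>R w" "sum a U = 1"
    by (auto simp: W_def)
  with a(2) show ?thesis by (intro exI[of _ a] bexI[of _ w] conjI)
qed

subsection \<open>Lattice points of small asymmetry\<close>

text \<open>Translating by the normal vector turns barycentric coordinates in the hyperplane into linear
  coordinates of the ambient space, so that determinants of full size apply.\<close>

lemma span_translated_hyperplane:
  fixes v :: "'a::euclidean_space"
  assumes v: "v \<noteq> 0" and S: "affine hull S = {x. v \<bullet> x = 0}"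
  shows "span ((+) v ` S) = UNIV"
proof -
  let ?S = "(+) v ` S"
  have "0 \<in> affine hull S" by (simp add: S)
  then obtain T u where T: "finite T" "T \<subseteq> S" "sum u T = 1" "(\<Sum>x\<in>T. u x *\<^sub>R x) = 0"
    by (auto simp: affine_hull_explicit)
  have "(\<Sum>x\<in>T. u x *\<^sub>R (v + x)) = v"
    using T by (simp add: scaleR_add_right sum.distrib flip: scaleR_sum_left)
  moreover have "(\<Sum>x\<in>T. u x *\<^sub>R (v + x)) \<in> span ?S"
    using T(2) by (intro span_sum span_scale span_base) auto
  ultimately have v_in: "v \<in> span ?S" by simp
  have "S \<subseteq> span ?S"
  proof
    fix x assume "x \<in> S"
    then have "v + x \<in> span ?S" by (intro span_base) auto
    then have "(v + x) - v \<in> span ?S" using v_in by (rule span_diff)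
    then show "x \<in> span ?S" by simp
  qed
  then have "affine hull S \<subseteq> span ?S"
    by (meson affine_hull_subset_span order_trans span_minimal subspace_span)
  have "y \<in> span ?S" for y
  proof -
    let ?c = "(v \<bullet> y) / (v \<bullet> v)"
    have "y - ?c *\<^sub>R v \<in> affine hull S" using v by (simp add: S inner_diff_right)
    then have "(y - ?c *\<^sub>R v) + ?c *\<^sub>R v \<in> span ?S"
      using \<open>affine hull S \<subseteq> span ?S\<close> v_in by (intro span_add span_scale) auto
    then show ?thesis by simp
  qed
  then show ?thesis by auto
qed

text \<open>The simplex consists of columns of maximal determinant in the translate of
  \<open>S\<close> by \<open>v\<close>, moved back; maximality bounds the barycentric
  coordinates.\<close>

lemma hyperplane_max_simplex:
  fixes v :: "real^'n"
  assumes v: "v \<noteq> 0" and S: "finite S" "affine hull S = {x. v \<bullet> x = 0}"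
  obtains t :: "'n \<Rightarrow> real^'n" where "range t \<subseteq> S" "inj t"
    "\<And>x. x \<in> S \<Longrightarrow> \<exists>\<beta>. (\<forall>j. \<beta> j \<le> 1) \<and> sum \<beta> UNIV = 1 \<and> x = (\<Sum>j\<in>UNIV. \<beta> j *\<^sub>R t j)"
proof -
  have perp: "v \<bullet> x = 0" if "x \<in> S" for x using S(2) hull_inc[OF that, of affine] by auto
  have "finite ((+) v ` S)" using S by simp
  then obtain f :: "'n \<Rightarrow> real^'n" where f: "range f \<subseteq> (+) v ` S" "inj f"
    and coord: "\<And>x. x \<in> (+) v ` S \<Longrightarrow> \<exists>\<beta>. (\<forall>j. \<bar>\<beta> j\<bar> \<le> 1) \<and> x = (\<Sum>j\<in>UNIV. \<beta> j *\<^sub>R f j)"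
    using span_translated_hyperplane[OF v S(2)] by (rule exists_max_det_subset) (rule that; assumption)
  show ?thesis
  proof (rule that[of "\<lambda>j. f j - v"])
    show t: "range (\<lambda>j. f j - v) \<subseteq> S"
    proof clarify
      fix j
      obtain x where "x \<in> S" "f j = v + x" using f(1) by (meson imageE range_subsetD)
      then show "f j - v \<in> S" by simp
    qed
    show "inj (\<lambda>j. f j - v)" using f(2) by (auto simp: inj_def)
    fix x assume x: "x \<in> S"
    then obtain \<beta> where \<beta>: "\<And>j. \<bar>\<beta> j\<bar> \<le> 1" "v + x = (\<Sum>j\<in>UNIV. \<beta> j *\<^sub>R f j)"
      using coord[of "v + x"] by blast
    \<comment> \<open>All \<open>f j\<close> and \<open>v + x\<close> have the same nonzero inner
      product with \<open>v\<close>, which forces the coefficients to sum to 1.\<close>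
    have "v \<bullet> f j = v \<bullet> v" for j using perp[of "f j - v"] t by (auto simp: inner_diff_right)
    then have "v \<bullet> (v + x) = sum \<beta> UNIV * (v \<bullet> v)"
      unfolding \<beta>(2) by (simp add: inner_sum_right sum_distrib_right)
    moreover have "v \<bullet> (v + x) = v \<bullet> v" using perp[OF x] by (simp add: inner_add_right)
    ultimately have sum1: "sum \<beta> UNIV = 1" using v by simp
    have "x = (\<Sum>j\<in>UNIV. \<beta> j *\<^sub>R (f j - v))"
      using sum1 \<beta>(2) by (simp add: scaleR_diff_right sum_subtractf flip: scaleR_sum_left) (metis add_diff_cancel_left')
    moreover have "\<beta> j \<le> 1" for j using \<beta>(1)[of j] by linarith
    ultimately show "\<exists>\<beta>. (\<forall>j. \<beta> j \<le> 1) \<and> sum \<beta> UNIV = 1 \<and> x = (\<Sum>j\<in>UNIV. \<beta> j *\<^sub>R (f j - v))"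
      using sum1 by blast
  qed
qed

text \<open>Prolong the segment from the centroid \<open>c\<close> of \<open>T\<close> through
  \<open>z\<close> slightly, to a point \<open>y\<close> of the hull. Caratheodory's theorem
  represents \<open>y\<close> by few points, and \<open>z\<close> is a combination of
  \<open>c\<close> and \<open>y\<close> with both weights positive.\<close>

lemma rel_interior_positive_combination:
  fixes z :: "'a::euclidean_space"
  assumes S: "finite S" and T: "T \<subseteq> S" "T \<noteq> {}" and z: "z \<in> rel_interior (convex hull S)"
  obtains U a where "T \<subseteq> U" "U \<subseteq> S" "int (card U) \<le> int (card T) + aff_dim S + 1"
    "\<And>u. u \<in> U \<Longrightarrow> 0 < a u" "sum a U = 1" "(\<Sum>u\<in>U. a u *\<^sub>R u) = z"
proof -
  have finT: "finite T" using S T finite_subset by auto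
  have cT: "card T > 0" using finT T by (simp add: card_gt_0_iff)
  define c where "c = (\<Sum>t\<in>T. (1 / card T) *\<^sub>R t)"
  have "c \<in> convex hull S"
    unfolding c_def using T finT cT
    by (intro convex_sum convex_convex_hull) (auto intro: hull_inc)
  then obtain e where e: "e > 1" "(1 - e) *\<^sub>R c + e *\<^sub>R z \<in> convex hull S"
    using z T convex_rel_interior_iff[of "convex hull S" z] by auto
  define y where "y = (1 - e) *\<^sub>R c + e *\<^sub>R z"
  obtain Y where Y: "finite Y" "Y \<subseteq> S" "card Y \<le> aff_dim S + 1" "y \<in> convex hull Y"
    using e(2) caratheodory_aff_dim[of S] by (auto simp: y_def)
  then obtain u where u: "\<forall>x\<in>Y. 0 \<le> u x" "sum u Y = 1" "(\<Sum>x\<in>Y. u x *\<^sub>R x) = y"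
    by (auto simp: convex_hull_finite)
  \<comment> \<open>Discarding zero coefficients makes every weight on the union of \<open>T\<close>
    and \<open>Y'\<close> positive.\<close>
  define Y' where "Y' = {x \<in> Y. 0 < u x}"
  have Y': "sum u Y' = 1" "(\<Sum>x\<in>Y'. u x *\<^sub>R x) = y" "Y' \<subseteq> Y"
  proof -
    show "Y' \<subseteq> Y" by (auto simp: Y'_def)
    show "sum u Y' = 1" unfolding u(2)[symmetric] Y'_def
      using Y(1) u(1) by (intro sum.mono_neutral_left) force+
    show "(\<Sum>x\<in>Y'. u x *\<^sub>R x) = y" unfolding u(3)[symmetric] Y'_def
      using Y(1) u(1) by (intro sum.mono_neutral_left) force+
  qed
  define b where "b p = (if p \<in> Y' then u p else 0)" for p
  define k where "k p = (if p \<in> T then 1 / real (card T) else 0)" for p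
  \<comment> \<open>Solving \<open>y = (1 - e) c + e z\<close> for \<open>z\<close> gives
    \<open>y\<close> the weight \<open>1 / e\<close> and \<open>c\<close> the weight
    \<open>(e - 1) / e\<close>.\<close>
  define a where "a p = b p / e + (e - 1) / e * k p" for p
  let ?U = "T \<union> Y'"
  have finU: "finite ?U" using finT Y Y' finite_subset by auto
  have b: "sum b ?U = 1" "(\<Sum>p\<in>?U. b p *\<^sub>R p) = y"
    unfolding Y'(1)[symmetric] Y'(2)[symmetric] using finU
    by (auto intro!: sum.mono_neutral_cong_right simp: b_def)
  have k: "sum k ?U = 1" "(\<Sum>p\<in>?U. k p *\<^sub>R p) = c"
  proof -
    have "sum k ?U = (\<Sum>p\<in>T. 1 / real (card T))"
      by (rule sum.mono_neutral_cong_right[OF finU]) (auto simp: k_def)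
    then show "sum k ?U = 1" using cT by simp
    show "(\<Sum>p\<in>?U. k p *\<^sub>R p) = c" unfolding c_def
      by (rule sum.mono_neutral_cong_right[OF finU]) (auto simp: k_def)
  qed
  show ?thesis
  proof (rule that[of ?U a])
    show "?U \<subseteq> S" using T Y Y' by auto
    have "card ?U \<le> card T + card Y" using card_Un_le[of T Y'] card_mono[OF Y(1) Y'(3)] by linarith
    then show "int (card ?U) \<le> int (card T) + aff_dim S + 1" using Y(3) by linarith
    show "0 < a p" if "p \<in> ?U" for p
    proof (cases "p \<in> T")
      case True
      have "0 \<le> b p" by (simp add: b_def Y'_def)
      moreover have "0 < k p" using True cT by (simp add: k_def)
      ultimately show ?thesis using e(1) by (simp add: a_def add_nonneg_pos)
    next
      case False
      then have "0 < b p" "k p = 0" using that by (auto simp: b_def Y'_def k_def)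
      then show ?thesis using e(1) by (simp add: a_def)
    qed
    have "sum a ?U = sum b ?U / e + (e - 1) / e * sum k ?U"
      by (simp add: a_def sum.distrib sum_divide_distrib sum_distrib_left)
    then show "sum a ?U = 1" using e(1) b k by (simp add: field_simps)
    have "(\<Sum>p\<in>?U. a p *\<^sub>R p) = (1 / e) *\<^sub>R (\<Sum>p\<in>?U. b p *\<^sub>R p) + ((e - 1) / e) *\<^sub>R (\<Sum>p\<in>?U. k p *\<^sub>R p)"
      by (simp add: a_def scaleR_add_left sum.distrib scaleR_sum_right)
    also have "\<dots> = (1 / e) *\<^sub>R y + ((e - 1) / e) *\<^sub>R c" by (simp only: b k)
    also have "\<dots> = ((1 - e) / e + (e - 1) / e) *\<^sub>R c + (e / e) *\<^sub>R z"
      unfolding y_def by (simp add: scaleR_add_right scaleR_add_left)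
    also have "\<dots> = z" using e(1) by (simp add: add_divide_distrib[symmetric])
    finally show "(\<Sum>p\<in>?U. a p *\<^sub>R p) = z" .
  qed auto
qed

text \<open>In \<open>s w\<close> every point of \<open>U\<close> has weight at least
  \<open>\<mu>\<close>, while a point \<open>x\<close> of \<open>S\<close> has coordinates at most 1
  in the maximal simplex inside \<open>U\<close>. Subtracting \<open>\<mu>\<close> times these
  coordinates leaves nonnegative weights, which represent \<open>(1 - \<mu>) y\<close>. The property
  is convex in \<open>x\<close> and so passes from \<open>S\<close> to its hull.\<close>

lemma small_asymmetry_hyperplane:
  fixes v :: "real^'n" and L :: "(real^'n) set" and s :: nat
  assumes s: "s \<ge> 1" and v: "v \<noteq> 0" and L: "add_subgroup L"
    and S: "finite S" "S \<subseteq> L" "affine hull S = {x. v \<bullet> x = 0}"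
    and z: "z \<in> L" "real s *\<^sub>R z \<in> rel_interior (convex hull S)"
    and \<mu>: "0 < \<mu>" "\<mu> < 1" "\<mu> \<le> 1 / (4 * real s + 3) ^ (2 ^ (2 * CARD('n) - 1))"
  obtains w where "w \<in> L"
    "\<And>x. x \<in> convex hull S \<Longrightarrow> \<exists>y\<in>convex hull S. real s *\<^sub>R w = \<mu> *\<^sub>R x + (1 - \<mu>) *\<^sub>R y"
proof -
  let ?C = "convex hull S"
  obtain t :: "'n \<Rightarrow> real^'n" where t: "range t \<subseteq> S" "inj t"
    and coord: "\<And>x. x \<in> S \<Longrightarrow> \<exists>\<beta>. (\<forall>j. \<beta> j \<le> 1) \<and> sum \<beta> UNIV = 1 \<and> x = (\<Sum>j\<in>UNIV. \<beta> j *\<^sub>R t j)"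
    using v S(1,3) by (rule hyperplane_max_simplex) (rule that; assumption)
  obtain U a0 where U: "range t \<subseteq> U" "U \<subseteq> S" "int (card U) \<le> int (card (range t)) + aff_dim S + 1"
    and a0: "\<And>u. u \<in> U \<Longrightarrow> 0 < a0 u" "sum a0 U = 1" "(\<Sum>u\<in>U. a0 u *\<^sub>R u) = real s *\<^sub>R z"
    using rel_interior_positive_combination[OF S(1) t(1) _ z(2)] by auto
  have finU: "finite U" "U \<noteq> {}" using U S finite_subset by auto
  \<comment> \<open>There are n simplex vertices and at most \<open>(n - 1) + 1\<close> further
    points, whence the exponent \<open>2 * n - 1\<close>.\<close>
  have "aff_dim S = int (CARD('n)) - 1"
    using aff_dim_hyperplane[OF v, of 0] aff_dim_affine_hull[of S] by (simp add: S(3))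
  then have cU: "card U \<le> 2 * CARD('n)" using U(3) t(2) by (simp add: card_image)
  have "U \<subseteq> L" using U S by blast
  have "\<exists>a. \<exists>w\<in>L. (\<Sum>u\<in>U. a u *\<^sub>R u) = real s *\<^sub>R w \<and> sum a U = 1 \<and>
    (\<forall>u\<in>U. 1 / (4 * real s + 3) ^ (2 ^ (card U - 1)) \<le> a u)"
    by (rule exists_balanced_lattice_point[OF s L finU \<open>U \<subseteq> L\<close> a0(1,2) z(1) a0(3)])
  then obtain a w where w: "w \<in> L" "(\<Sum>u\<in>U. a u *\<^sub>R u) = real s *\<^sub>R w" and a1: "sum a U = 1"
    and a: "\<forall>u\<in>U. 1 / (4 * real s + 3) ^ (2 ^ (card U - 1)) \<le> a u"
    by (elim exE bexE conjE) (rule that)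
  have a\<mu>: "\<mu> \<le> a u" if "u \<in> U" for u
  proof -
    have "1 / (4 * real s + 3) ^ (2 ^ (2 * CARD('n) - 1)) \<le> 1 / (4 * real s + 3) ^ (2 ^ (card U - 1))"
    proof (intro divide_left_mono power_increasing mult_pos_pos)
      show "card U - 1 \<le> 2 * CARD('n) - 1" using cU by linarith
    qed auto
    then show ?thesis using \<mu>(3) bspec[OF a that] by linarith
  qed
  define G where "G = {x. \<exists>y\<in>?C. real s *\<^sub>R w = \<mu> *\<^sub>R x + (1 - \<mu>) *\<^sub>R y}"
  have "S \<subseteq> G"
  proof
    fix x assume "x \<in> S"
    then obtain \<beta> where \<beta>: "\<And>j. \<beta> j \<le> 1" "sum \<beta> UNIV = 1" "x = (\<Sum>j\<in>UNIV. \<beta> j *\<^sub>R t j)"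
      using coord by blast
    \<comment> \<open>The simplex coordinates of \<open>x\<close>, extended by 0 to the rest of
      \<open>U\<close>.\<close>
    define b where "b u = (if u \<in> range t then \<beta> (inv t u) else 0)" for u
    have bt: "b (t j) = \<beta> j" for j using t(2) by (simp add: b_def)
    have "sum b U = sum b (range t)"
      using finU U(1) by (intro sum.mono_neutral_right) (auto simp: b_def)
    then have b1: "sum b U = 1" using \<beta>(2) by (simp add: sum.reindex[OF t(2)] o_def bt)
    have "(\<Sum>u\<in>U. b u *\<^sub>R u) = (\<Sum>u\<in>range t. b u *\<^sub>R u)"
      using finU U(1) by (intro sum.mono_neutral_right) (auto simp: b_def)
    then have bx: "(\<Sum>u\<in>U. b u *\<^sub>R u) = x" using \<beta>(3) by (simp add: sum.reindex[OF t(2)] o_def bt)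
    have ble: "b u \<le> 1" for u using \<beta>(1) by (simp add: b_def)
    let ?y = "\<Sum>u\<in>U. ((a u - \<mu> * b u) / (1 - \<mu>)) *\<^sub>R u"
    have "?y \<in> ?C"
    proof (rule convex_sum[OF finU(1) convex_convex_hull])
      have "(\<Sum>u\<in>U. (a u - \<mu> * b u) / (1 - \<mu>)) = (sum a U - \<mu> * sum b U) / (1 - \<mu>)"
        by (simp add: sum_subtractf sum_distrib_left flip: sum_divide_distrib)
      then show "(\<Sum>u\<in>U. (a u - \<mu> * b u) / (1 - \<mu>)) = 1" using a1 b1 \<mu> by simp
      fix u assume u: "u \<in> U"
      have "\<mu> * b u \<le> \<mu> * 1" using ble \<mu>(1) by (intro mult_left_mono) auto
      then have "\<mu> * b u \<le> a u" using a\<mu>[OF u] by linarith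
      then show "0 \<le> (a u - \<mu> * b u) / (1 - \<mu>)" using \<mu>(2) by simp
      show "u \<in> ?C" using u U by (auto intro: hull_inc)
    qed
    moreover have "(1 - \<mu>) *\<^sub>R ?y = real s *\<^sub>R w - \<mu> *\<^sub>R x"
    proof -
      have "(1 - \<mu>) *\<^sub>R ?y = (\<Sum>u\<in>U. (a u - \<mu> * b u) *\<^sub>R u)"
        using \<mu> by (simp add: scaleR_sum_right)
      also have "\<dots> = (\<Sum>u\<in>U. a u *\<^sub>R u) - \<mu> *\<^sub>R (\<Sum>u\<in>U. b u *\<^sub>R u)"
        by (simp add: scaleR_diff_left sum_subtractf scaleR_sum_right)
      finally show ?thesis by (simp add: w bx)
    qed
    ultimately show "x \<in> G" unfolding G_def by (intro CollectI bexI[of _ ?y]) auto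
  qed
  moreover have "convex G"
  proof (rule convexI)
    fix x1 x2 and p q :: real
    assume "x1 \<in> G" "x2 \<in> G" and pq: "0 \<le> p" "0 \<le> q" "p + q = 1"
    then obtain y1 y2 where y: "y1 \<in> ?C" "y2 \<in> ?C"
      "real s *\<^sub>R w = \<mu> *\<^sub>R x1 + (1 - \<mu>) *\<^sub>R y1" "real s *\<^sub>R w = \<mu> *\<^sub>R x2 + (1 - \<mu>) *\<^sub>R y2"
      unfolding G_def by blast
    have "real s *\<^sub>R w = p *\<^sub>R (real s *\<^sub>R w) + q *\<^sub>R (real s *\<^sub>R w)"
      using pq(3) by (metis scaleR_add_left scaleR_one)
    also have "\<dots> = p *\<^sub>R (\<mu> *\<^sub>R x1 + (1 - \<mu>) *\<^sub>R y1) + q *\<^sub>R (\<mu> *\<^sub>R x2 + (1 - \<mu>) *\<^sub>R y2)"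
      using y(3,4) by metis
    also have "\<dots> = \<mu> *\<^sub>R (p *\<^sub>R x1 + q *\<^sub>R x2) + (1 - \<mu>) *\<^sub>R (p *\<^sub>R y1 + q *\<^sub>R y2)"
      by (simp add: scaleR_add_right mult.commute)
    finally show "p *\<^sub>R x1 + q *\<^sub>R x2 \<in> G"
      unfolding G_def using convexD[OF convex_convex_hull y(1,2) pq] by blast
  qed
  ultimately have "?C \<subseteq> G" by (rule hull_minimal)
  then show ?thesis using that w(1) unfolding G_def by blast
qed

subsection \<open>Blichfeldt's theorem\<close>

lemma finite_int_lattice_bounded: "finite {z :: real^'n. z \<in> int_lattice \<and> norm z \<le> b}"
proof -
  have "{z :: real^'n. z \<in> int_lattice \<and> norm z \<le> b}
      \<subseteq> (\<lambda>f. \<chi> i. real_of_int (f i)) ` (UNIV \<rightarrow>\<^sub>E {\<lfloor>- b\<rfloor>..\<lceil>b\<rceil>})"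
  proof clarify
    fix z :: "real^'n" assume z: "z \<in> int_lattice" "norm z \<le> b"
    have "z = (\<chi> i. real_of_int \<lfloor>z $ i\<rfloor>)" using z(1) by (simp add: int_lattice_def vec_eq_iff)
    moreover have "(\<lambda>i. \<lfloor>z $ i\<rfloor>) \<in> UNIV \<rightarrow>\<^sub>E {\<lfloor>- b\<rfloor>..\<lceil>b\<rceil>}"
    proof (intro PiE_I)
      fix i
      have "\<bar>z $ i\<bar> \<le> b" using component_le_norm_cart[of z i] z(2) by linarith
      then show "\<lfloor>z $ i\<rfloor> \<in> {\<lfloor>- b\<rfloor>..\<lceil>b\<rceil>}" by (auto intro: floor_mono) linarith
    qed simp
    ultimately show "z \<in> (\<lambda>f. \<chi> i. real_of_int (f i)) ` (UNIV \<rightarrow>\<^sub>E {\<lfloor>- b\<rfloor>..\<lceil>b\<rceil>})" by (rule image_eqI)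
  qed
  then show ?thesis by (rule finite_subset) (simp add: finite_PiE)
qed

text \<open>A fundamental cell of \<open>int_lattice\<close>: half open, so that its integer
  translates cover the space without overlap.\<close>

definition half_open_cube :: "(real^'n) set" where
  "half_open_cube = {x. \<forall>i. 0 \<le> x $ i \<and> x $ i < 1}"

lemma half_open_cube_bounds: "box 0 1 \<subseteq> half_open_cube" "half_open_cube \<subseteq> cbox 0 1"
  by (auto simp: half_open_cube_def mem_box_cart less_imp_le)

lemma lmeasurable_linear_half_open_cube:
  assumes "linear f" shows "f ` (half_open_cube :: (real^'n) set) \<in> lmeasurable"
proof (rule measurable_convex)
  have "convex (half_open_cube :: (real^'n) set)"
    unfolding half_open_cube_def convex_def
    by (auto simp: convex_bound_lt intro!: add_nonneg_nonneg)
  then show "convex (f ` (half_open_cube :: (real^'n) set))" by (rule convex_linear_image[OF assms])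
  have "bounded (half_open_cube :: (real^'n) set)"
    using half_open_cube_bounds(2) bounded_cbox bounded_subset by blast
  then show "bounded (f ` (half_open_cube :: (real^'n) set))"
    using assms by (simp add: bounded_linear_image linear_linear)
qed

lemma measure_half_open_cube: "measure lebesgue (half_open_cube :: (real^'n) set) = 1"
proof (rule antisym)
  have m: "(half_open_cube :: (real^'n) set) \<in> lmeasurable"
    using lmeasurable_linear_half_open_cube[OF linear_id] by simp
  have box: "measure lebesgue (cbox 0 1 :: (real^'n) set) = 1"
    by (simp add: content_cbox_cart interval_ne_empty_cart)
  then show "measure lebesgue (half_open_cube :: (real^'n) set) \<le> 1"
    by (metis half_open_cube_bounds(2) lmeasurable_cbox m measure_mono_fmeasurable fmeasurableD)
  have "measure lebesgue (box 0 1 :: (real^'n) set) = 1"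
    using box by (simp add: measure_lborel_box_eq measure_lborel_cbox_eq)
  then show "1 \<le> measure lebesgue (half_open_cube :: (real^'n) set)"
    by (metis half_open_cube_bounds(1) lmeasurable_box m measure_mono_fmeasurable fmeasurableD)
qed

text \<open>Cut \<open>X\<close> along the lattice translates of the fundamental cell and move every
  piece into the cell. If distinct points of \<open>X\<close> never differed by a lattice vector,
  the pieces would be disjoint there, and \<open>X\<close> would have at most the volume of the
  cell.\<close>

theorem Blichfeldt:
  fixes f :: "real^'n \<Rightarrow> real^'n" and X :: "(real^'n) set"
  assumes f: "linear f" "inj f" and X: "X \<in> lmeasurable" "bounded X"
    and vol: "measure lebesgue (f ` half_open_cube) < measure lebesgue X"
  obtains x y where "x \<in> X" "y \<in> X" "x \<noteq> y" "x - y \<in> f ` int_lattice"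
proof (rule ccontr)
  assume neg: "\<not> thesis"
  let ?\<mu> = "measure lebesgue" and ?F = "f ` (half_open_cube :: (real^'n) set)"
  have dj: "x = y" if "x \<in> X" "y \<in> X" "x - y \<in> f ` int_lattice" for x y
    using neg that(1,2,3) \<open>\<And>x y. \<lbrakk>x \<in> X; y \<in> X; x \<noteq> y; x - y \<in> f ` int_lattice\<rbrakk> \<Longrightarrow> thesis\<close> by blast
  obtain g where g: "linear g" "g \<circ> f = id" "f \<circ> g = id"
    using linear_injective_isomorphism[OF f] by (auto simp: o_def id_def)
  have fg: "f (g x) = x" for x using g by (metis comp_apply id_apply)
  define fl where "fl x = (\<chi> i. real_of_int \<lfloor>x $ i\<rfloor>)" for x :: "real^'n"
  have fl: "fl x \<in> int_lattice" "x - fl x \<in> half_open_cube" for x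
    unfolding fl_def int_lattice_def half_open_cube_def by (auto simp: diff_le_eq) linarith
  \<comment> \<open>The lattice parts of the points of \<open>X\<close>, in coordinates. Boundedness
    of \<open>X\<close> makes this set finite, so finite additivity suffices.\<close>
  define Z where "Z = (\<lambda>x. fl (g x)) ` X"
  have "bounded (half_open_cube :: (real^'n) set)"
    using half_open_cube_bounds(2) bounded_cbox bounded_subset by blast
  moreover have "bounded (g ` X)" using bounded_linear_image[OF X(2)] g(1) by (simp add: linear_linear)
  ultimately obtain b c where b: "\<And>q :: real^'n. q \<in> half_open_cube \<Longrightarrow> norm q \<le> b"
      and c: "\<And>x. x \<in> X \<Longrightarrow> norm (g x) \<le> c"
    unfolding bounded_iff by auto
  have "norm (fl (g x)) \<le> c + b" if "x \<in> X" for x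
  proof -
    have "norm (fl (g x)) \<le> norm (g x) + norm (g x - fl (g x))"
      by (metis norm_minus_commute norm_triangle_sub)
    then show ?thesis using b[OF fl(2)[of "g x"]] c[OF that] by linarith
  qed
  then have finZ: "finite Z"
    using fl(1) by (intro finite_subset[OF _ finite_int_lattice_bounded[of "c + b"]]) (auto simp: Z_def)
  have ZI: "z \<in> int_lattice" if "z \<in> Z" for z using that fl(1) by (auto simp: Z_def)
  \<comment> \<open>The piece of \<open>X\<close> in the cell at \<open>f z\<close>, moved to the
    cell at the origin.\<close>
  define Y where "Y z = (+) (- f z) ` X \<inter> ?F" for z
  have Fm: "?F \<in> lmeasurable" by (rule lmeasurable_linear_half_open_cube[OF f(1)])
  have Ym: "Y z \<in> lmeasurable" for z
    unfolding Y_def by (intro fmeasurable.Int measurable_translation X Fm)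
  have "disjoint_family_on Y Z"
  proof (unfold disjoint_family_on_def, intro ballI impI, rule ccontr)
    fix z z' assume z: "z \<in> Z" "z' \<in> Z" "z \<noteq> z'" and "Y z \<inter> Y z' \<noteq> {}"
    then obtain x y where xy: "x \<in> X" "y \<in> X" "- f z + x = - f z' + y" by (auto simp: Y_def)
    then have "x - y = f (z - z')" by (simp add: linear_diff[OF f(1)] algebra_simps)
    moreover have "z - z' \<in> int_lattice" using ZI z by (auto simp: int_lattice_def)
    ultimately have "x = y" using dj xy by blast
    then have "f z = f z'" using xy(3) by simp
    then show False using z(3) f(2) by (auto dest: injD)
  qed
  then have "(\<Sum>z\<in>Z. ?\<mu> (Y z)) = ?\<mu> (\<Union>z\<in>Z. Y z)"
    using fmeasurableD2[OF Ym] fmeasurableD[OF Ym]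
    by (intro measure_finite_Union[OF finZ, symmetric] image_subsetI) auto
  also have "\<dots> \<le> ?\<mu> ?F"
    by (intro measure_mono_fmeasurable sets.finite_UN finZ fmeasurableD Ym Fm) (auto simp: Y_def)
  finally have sumY: "(\<Sum>z\<in>Z. ?\<mu> (Y z)) \<le> ?\<mu> ?F" .
  have "X \<subseteq> (\<Union>z\<in>Z. (+) (f z) ` Y z)"
  proof
    fix x assume x: "x \<in> X"
    have "- f (fl (g x)) + x = f (g x - fl (g x))" by (simp add: linear_diff[OF f(1)] fg)
    then have "- f (fl (g x)) + x \<in> Y (fl (g x))" using x fl(2) unfolding Y_def by blast
    then have "x \<in> (+) (f (fl (g x))) ` Y (fl (g x))" by (rule image_eqI[rotated]) simp
    moreover have "fl (g x) \<in> Z" using x by (simp add: Z_def)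
    ultimately show "x \<in> (\<Union>z\<in>Z. (+) (f z) ` Y z)" by blast
  qed
  then have "?\<mu> X \<le> ?\<mu> (\<Union>z\<in>Z. (+) (f z) ` Y z)"
    using X finZ Ym by (intro measure_mono_fmeasurable fmeasurable.finite_UN measurable_translation) (auto intro: fmeasurableD)
  also have "\<dots> \<le> (\<Sum>z\<in>Z. ?\<mu> ((+) (f z) ` Y z))"
    using Ym by (intro measure_UNION_le finZ fmeasurableD measurable_translation)
  also have "\<dots> = (\<Sum>z\<in>Z. ?\<mu> (Y z))" by (simp add: measure_translation)
  finally show False using sumY vol by linarith
qed

subsection \<open>The volume bound\<close>

lemma add_subgroup_int_lattice: "add_subgroup int_lattice"
  by (auto simp: add_subgroup_def int_lattice_def)

lemma add_subgroup_linear_image: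
  assumes "linear f" "add_subgroup L" shows "add_subgroup (f ` L)"
  using assms(2) linear_0[OF assms(1)] linear_diff[OF assms(1), symmetric]
  by (auto simp: add_subgroup_def image_iff)

text \<open>The point at \<open>t\<close> lies on the segment from the interior point at
  \<open>t0\<close> to one of the two ends and differs from that end; such points of a convex set
  are interior.\<close>

lemma convex_line_interior:
  fixes P :: "'a::euclidean_space set"
  assumes P: "convex P" and int: "p + t0 *\<^sub>R z \<in> interior P"
    and ends: "p + t1 *\<^sub>R z \<in> P" "p + t2 *\<^sub>R z \<in> P" and t: "t1 < t" "t < t2"
  shows "p + t *\<^sub>R z \<in> interior P"
proof -
  have key: "p + t *\<^sub>R z \<in> interior P" if u: "p + u *\<^sub>R z \<in> P" "u < t \<and> t \<le> t0 \<or> t0 \<le> t \<and> t < u" for u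
  proof -
    define e where "e = (t - u) / (t0 - u)"
    have e: "0 < e" "e \<le> 1" "e * (t0 - u) = t - u" using u(2) by (auto simp: e_def field_simps)
    have "p + u *\<^sub>R z - e *\<^sub>R (p + u *\<^sub>R z - (p + t0 *\<^sub>R z)) = p + (u + e * (t0 - u)) *\<^sub>R z"
      by (simp add: algebra_simps)
    then have "p + u *\<^sub>R z - e *\<^sub>R (p + u *\<^sub>R z - (p + t0 *\<^sub>R z)) = p + t *\<^sub>R z" by (simp only: e(3)) simp
    then show ?thesis using mem_interior_convex_shrink[OF P int u(1) e(1,2)] by metis
  qed
  show ?thesis using key[OF ends(1)] key[OF ends(2)] t by (cases "t \<le> t0") auto
qed

section \<open>Projection along a lattice vector\<close>

text \<open>The quotient by the line through \<open>z\<close> is realised as the hyperplane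
  orthogonal to \<open>z\<close>, since the target in \<open>lattice_projection\<close> is a
  subspace of the same space. The projected lattice is in general not contained in
  \<open>int_lattice\<close>.\<close>

definition orth_proj :: "'a::real_inner \<Rightarrow> 'a \<Rightarrow> 'a" where
  "orth_proj z x = x - ((z \<bullet> x) / (z \<bullet> z)) *\<^sub>R z"

lemma linear_orth_proj: "linear (orth_proj z)"
  by (rule linearI) (simp_all add: orth_proj_def inner_add_right add_divide_distrib algebra_simps)

lemma orth_proj_self: "orth_proj z z = 0"
  by (cases "z = 0") (simp_all add: orth_proj_def)

lemma range_orth_proj: "z \<noteq> 0 \<Longrightarrow> range (orth_proj z) = {x. z \<bullet> x = 0}"
proof safe
  fix x assume "z \<noteq> 0" "z \<bullet> x = 0"
  then have "x = orth_proj z x" by (simp add: orth_proj_def)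
  then show "x \<in> range (orth_proj z)" by blast
qed (simp add: orth_proj_def inner_diff_right)

lemma orth_proj_eqD:
  assumes "orth_proj z x = orth_proj z y" shows "\<exists>t. x = y + t *\<^sub>R z"
  using assms by (intro exI[of _ "(z \<bullet> x) / (z \<bullet> z) - (z \<bullet> y) / (z \<bullet> z)"])
    (simp add: orth_proj_def algebra_simps)

text \<open>The kernel is the line through the two lattice points 0 and \<open>z\<close>.\<close>

lemma lattice_projection_orth_proj:
  assumes z: "z \<in> int_lattice" "z \<noteq> 0"
  shows "lattice_projection (orth_proj z) {x. z \<bullet> x = 0}"
proof -
  let ?K = "orth_proj z -` {0}"
  have "?K \<subseteq> affine hull {0, z}"
  proof
    fix x assume "x \<in> ?K"
    then obtain t where "x = 0 + t *\<^sub>R z"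
      using orth_proj_eqD[of z x 0] linear_0[OF linear_orth_proj[of z]] by auto
    then show "x \<in> affine hull {0, z}" unfolding affine_hull_2 by (force intro: exI[of _ "1 - t"])
  qed
  also have "\<dots> \<subseteq> affine hull (?K \<inter> int_lattice)"
    using z orth_proj_self linear_0[OF linear_orth_proj[of z]] by (intro hull_mono) (auto simp: int_lattice_def)
  finally have "?K \<subseteq> affine hull (?K \<inter> int_lattice)" .
  moreover have "affine ?K"
    using linear_orth_proj linear_subspace_vimage subspace_imp_affine subspace_single_0 by blast
  then have "affine hull (?K \<inter> int_lattice) \<subseteq> ?K" by (intro hull_minimal) auto
  ultimately show ?thesis
    unfolding lattice_projection_def
    using linear_orth_proj range_orth_proj[OF z(2)] subspace_hyperplane[of z]
    by (intro conjI exI[of _ "orth_proj z"] exI[of _ 0]) auto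
qed

text \<open>Here \<open>\<mu>\<close> is the reciprocal of the number in the volume bound. For n = 1
  that number is 1 and the hyperplane is a point; otherwise \<open>8 * (n - 1)\<close> exceeds 1 and
  \<open>8 * s + 7\<close> exceeds \<open>4 * s + 3\<close>, so \<open>\<mu>\<close> is small
  enough.\<close>

lemma small_asymmetry_hyperplane_explicit:
  fixes v :: "real^'n" and L :: "(real^'n) set" and s :: nat
  assumes s: "s \<ge> 1" and v: "v \<noteq> 0" and L: "add_subgroup L"
    and S: "finite S" "S \<subseteq> L" "affine hull S = {x. v \<bullet> x = 0}"
    and z: "z \<in> L" "real s *\<^sub>R z \<in> rel_interior (convex hull S)"
    and \<mu>: "\<mu> = 1 / (8 * (real CARD('n) - 1) * (8 * real s + 7) ^ (2 ^ (2 * CARD('n) - 1)) + 1)"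
  shows "\<exists>w\<in>L. \<forall>x\<in>convex hull S. \<exists>y\<in>convex hull S. real s *\<^sub>R w = \<mu> *\<^sub>R x + (1 - \<mu>) *\<^sub>R y"
proof (cases "CARD('n) = 1")
  case True
  then have "aff_dim (convex hull S) = 0"
    using aff_dim_hyperplane[OF v, of 0] aff_dim_affine_hull[of S] by (simp add: S(3) aff_dim_convex_hull)
  then obtain a where "convex hull S = {a}" unfolding aff_dim_eq_0 by blast
  moreover have "real s *\<^sub>R z \<in> convex hull S" using z(2) rel_interior_subset by blast
  moreover have "\<mu> = 1" using True by (simp add: \<mu>)
  ultimately show ?thesis using z(1) by auto
next
  case False
  then have d: "CARD('n) \<ge> 2" using zero_less_card_finite[where 'a='n] by linarith
  let ?X = "(8 * real s + 7) ^ (2 ^ (2 * CARD('n) - 1))"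
  have X: "?X > 0" by simp
  have "1 * ?X \<le> (8 * (real CARD('n) - 1)) * ?X" using d X by (intro mult_right_mono) auto
  then have R: "?X + 1 \<le> 8 * (real CARD('n) - 1) * ?X + 1" by simp
  have "0 < \<mu>" using R X unfolding \<mu> by (intro divide_pos_pos) linarith+
  moreover have "\<mu> < 1" using R X unfolding \<mu> by (subst divide_less_eq_1_pos) linarith+
  moreover have "\<mu> \<le> 1 / (4 * real s + 3) ^ (2 ^ (2 * CARD('n) - 1))"
  proof -
    have "(4 * real s + 3) ^ (2 ^ (2 * CARD('n) - 1)) \<le> ?X" by (intro power_mono) auto
    then have le: "(4 * real s + 3) ^ (2 ^ (2 * CARD('n) - 1)) \<le> 8 * (real CARD('n) - 1) * ?X + 1"
      using R by linarith
    then show ?thesis unfolding \<mu> by (intro divide_left_mono mult_pos_pos less_le_trans[OF _ le]) auto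
  qed
  ultimately obtain w where "w \<in> L"
    "\<And>x. x \<in> convex hull S \<Longrightarrow> \<exists>y\<in>convex hull S. real s *\<^sub>R w = \<mu> *\<^sub>R x + (1 - \<mu>) *\<^sub>R y"
    using small_asymmetry_hyperplane[OF s v L S z] by metis
  then show ?thesis by blast
qed

text \<open>Blichfeldt's theorem for \<open>r\<close> times the integer lattice, with cell volume
  \<open>r ^ n\<close>. Taking \<open>r\<close> strictly between \<open>t\<close> and the n-th root
  of the volume keeps both inequalities strict.\<close>

lemma int_lattice_diff_in_large_body:
  fixes P :: "(real^'n) set"
  assumes P: "P \<in> lmeasurable" "bounded P" and t: "t > 0" "t ^ CARD('n) < measure lebesgue P"
  obtains r x y z where "t < r" "x \<in> P" "y \<in> P" "x - y = r *\<^sub>R z" "z \<in> int_lattice" "z \<noteq> 0"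
proof -
  let ?n = "CARD('n)" and ?V = "measure lebesgue P"
  have Vpos: "?V > 0" using t by (meson less_trans zero_less_power)
  define q where "q = root ?n ?V"
  have q: "q > 0" "q ^ ?n = ?V" using Vpos by (auto simp: q_def)
  have "t < q" using t q by (metis less_imp_le power_less_imp_less_base)
  then obtain r where r: "t < r" "r < q" using dense by blast
  define f where "f x = r *\<^sub>R x" for x :: "real^'n"
  have f: "linear f" "inj f" using r t by (auto simp: f_def linear_iff scaleR_add_right inj_def)
  have "measure lebesgue (f ` (half_open_cube :: (real^'n) set)) = r ^ ?n"
    using measure_lebesgue_affine[of r "0 :: real^'n" half_open_cube] r t
    by (simp add: f_def measure_half_open_cube)
  also have "\<dots> < ?V" using power_strict_mono[of r q ?n] r t q by simp
  finally obtain x y where "x \<in> P" "y \<in> P" "x \<noteq> y" "x - y \<in> f ` int_lattice"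
    by (rule Blichfeldt[OF f P])
  moreover from this obtain z where "z \<in> int_lattice" "x - y = r *\<^sub>R z" by (auto simp: f_def)
  moreover from this have "z \<noteq> 0" using \<open>x \<noteq> y\<close> by auto
  ultimately show ?thesis using that r(1) by blast
qed

lemma lattice_polytope_facts:
  fixes P :: "(real^'n) set"
  assumes "lattice_polytope int_lattice P"
  shows "compact P" "convex P" "bounded P" "P \<in> lmeasurable"
proof -
  show "compact P" "convex P"
    using assms by (auto simp: lattice_polytope_def finite_imp_compact_convex_hull)
  then show "bounded P" "P \<in> lmeasurable" by (auto simp: compact_imp_bounded lmeasurable_compact)
qed

lemma volume_bound:
  fixes P :: "(real^'n) set"
  defines "d \<equiv> CARD('n)"
  assumes s: "s \<ge> 1" and P: "s_hollow_d_polytope s P" and np: "\<not> projects_to_s_hollow (d - 1) s P"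
  shows "measure lebesgue P \<le> real s ^ d * (8 * (real d - 1) * (8 * real s + 7) ^ (2 ^ (2 * d - 1)) + 1) ^ d"
proof (rule ccontr)
  assume neg: "\<not> ?thesis"
  define R where "R = 8 * (real d - 1) * (8 * real s + 7) ^ (2 ^ (2 * d - 1)) + 1"
  have "d \<ge> 1" by (simp add: d_def Suc_leI)
  then have R: "R \<ge> 1" by (simp add: R_def)
  from P have lat: "lattice_polytope int_lattice P" and full: "aff_dim P = int d"
    and hollow: "interior P \<inter> (\<lambda>x. real s *\<^sub>R x) ` int_lattice = {}"
    by (auto simp: s_hollow_d_polytope_def s_hollow_UNIV d_def)
  note PP = lattice_polytope_facts[OF lat]
  from lat obtain S where S: "finite S" "S \<subseteq> int_lattice" "P = convex hull S"
    by (auto simp: lattice_polytope_def)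
  have aff: "affine hull P = UNIV" using full aff_dim_eq_full[of P] by (simp add: d_def)
  have sR: "real s * R > 0" using s R by simp
  have big: "(real s * R) ^ CARD('n) < measure lebesgue P"
    using neg by (simp add: R_def d_def power_mult_distrib)
  obtain r x y z where r: "real s * R < r" and xy: "x \<in> P" "y \<in> P" "x - y = r *\<^sub>R z"
    and z: "z \<in> int_lattice" "z \<noteq> 0"
    by (rule int_lattice_diff_in_large_body[OF PP(4,3) sR big])
  let ?p = "orth_proj z" and ?V = "{x. z \<bullet> x = 0}"
  note lin = linear_orth_proj[of z]
  let ?L = "?p ` int_lattice"
  have pP: "?p ` P = convex hull (?p ` S)" using S(3) convex_hull_linear_image[OF lin] by metis
  have affV: "affine hull (?p ` P) = ?V"
    using affine_hull_linear_image[of ?p P] lin by (simp add: aff range_orth_proj[OF z(2)] linear_linear)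
  then have affS: "affine hull (?p ` S) = ?V" by (simp add: pP)
  have dimP: "aff_dim (?p ` P) = int (d - 1)"
    using aff_dim_hyperplane[OF z(2), of 0] aff_dim_affine_hull[of "?p ` P"] \<open>d \<ge> 1\<close>
    by (simp add: affV d_def of_nat_diff)
  \<comment> \<open>The image meets all other conditions of \<open>projects_to_s_hollow\<close>, so
    by \<open>np\<close> hollowness must fail.\<close>
  have "\<not> s_hollow ?V ?L s (?p ` P)"
  proof
    assume "s_hollow ?V ?L s (?p ` P)"
    moreover have "lattice_polytope ?L (?p ` P)"
      unfolding lattice_polytope_def using S pP by (intro exI[of _ "?p ` S"]) auto
    moreover have "dim ?V = d - 1" using dim_hyperplane[OF z(2)] by (simp add: d_def)
    ultimately show False
      using np lattice_projection_orth_proj[OF z] dimP unfolding projects_to_s_hollow_def by blast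
  qed
  then obtain z0 where z0: "z0 \<in> ?L" "real s *\<^sub>R z0 \<in> top_of_set ?V interior_of (?p ` P)"
    by (auto simp: s_hollow_def)
  \<comment> \<open>The affine hull of the image is \<open>?V\<close>, so its interior in
    \<open>?V\<close> is its relative interior.\<close>
  have "real s *\<^sub>R z0 \<in> rel_interior (?p ` P)"
    using z0(2) unfolding rel_interior_def interior_of_def affV by auto
  then have "\<exists>w\<in>?L. \<forall>x\<in>?p ` P. \<exists>y\<in>?p ` P. real s *\<^sub>R w = (1 / R) *\<^sub>R x + (1 - 1 / R) *\<^sub>R y"
    unfolding pP using S(1,2)
    by (intro small_asymmetry_hyperplane_explicit[OF s z(2) add_subgroup_linear_image[OF lin add_subgroup_int_lattice] _ _ affS z0(1)])
      (auto simp: R_def d_def)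
  then obtain g where g: "g \<in> int_lattice"
    and asym: "\<And>x. x \<in> P \<Longrightarrow> \<exists>y\<in>P. real s *\<^sub>R ?p g = (1 / R) *\<^sub>R ?p x + (1 - 1 / R) *\<^sub>R ?p y"
    by auto
  have fibre: "\<exists>t. (1 / R) *\<^sub>R x + (1 - 1 / R) *\<^sub>R y = real s *\<^sub>R g + t *\<^sub>R z"
    if "real s *\<^sub>R ?p g = (1 / R) *\<^sub>R ?p x + (1 - 1 / R) *\<^sub>R ?p y" for x y
    using that by (intro orth_proj_eqD) (simp add: linear_add[OF lin] linear_scale[OF lin])
  have R1: "0 \<le> 1 - 1 / R" "0 < 1 / R" "1 / R \<le> 1" using R by auto
  have comb: "(1 / R) *\<^sub>R x + (1 - 1 / R) *\<^sub>R y \<in> P" if "x \<in> P" "y \<in> P" for x y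
    using convexD[OF PP(2) that, of "1 / R" "1 - 1 / R"] R1 by simp
  obtain p0 where p0: "p0 \<in> interior P"
    using rel_interior_interior[OF aff] rel_interior_eq_empty[OF PP(2)] aff by fastforce
  \<comment> \<open>An interior point on the fibre ensures that the segment found below does not run
    in the boundary. It comes from the asymmetry property at \<open>p0\<close>: positive weight on
    an interior point keeps the combination interior.\<close>
  obtain t0 where t0: "real s *\<^sub>R g + t0 *\<^sub>R z \<in> interior P"
  proof -
    obtain q where q: "q \<in> P" "real s *\<^sub>R ?p g = (1 / R) *\<^sub>R ?p p0 + (1 - 1 / R) *\<^sub>R ?p q"
      using asym p0 interior_subset by blast
    have "q - (1 / R) *\<^sub>R (q - p0) \<in> interior P"
      by (rule mem_interior_convex_shrink[OF PP(2) p0 q(1) R1(2,3)])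
    then have "(1 / R) *\<^sub>R p0 + (1 - 1 / R) *\<^sub>R q \<in> interior P" by (simp add: algebra_simps)
    then show ?thesis using that fibre[OF q(2)] by metis
  qed
  \<comment> \<open>Since \<open>x\<close> and \<open>y\<close> have the same image, one
    \<open>q\<close> serves both, giving two points of the fibre that are \<open>r / R\<close> apart
    in units of \<open>z\<close>.\<close>
  obtain q where q: "q \<in> P" "real s *\<^sub>R ?p g = (1 / R) *\<^sub>R ?p x + (1 - 1 / R) *\<^sub>R ?p q"
    using asym xy(1) by blast
  have xy_eq: "x = y + r *\<^sub>R z" using xy(3) by (simp add: algebra_simps)
  then have "?p x = ?p y"
    by (simp add: linear_add[OF lin] linear_scale[OF lin] orth_proj_self)
  then obtain t1 where t1: "(1 / R) *\<^sub>R y + (1 - 1 / R) *\<^sub>R q = real s *\<^sub>R g + t1 *\<^sub>R z"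
    using fibre[of y q] q(2) by auto
  have "(1 / R) *\<^sub>R x + (1 - 1 / R) *\<^sub>R q = ((1 / R) *\<^sub>R y + (1 - 1 / R) *\<^sub>R q) + (r / R) *\<^sub>R z"
    by (simp add: xy_eq scaleR_add_right)
  also have "\<dots> = real s *\<^sub>R g + (t1 + r / R) *\<^sub>R z" unfolding t1 by (simp add: scaleR_add_left)
  finally have t2: "(1 / R) *\<^sub>R x + (1 - 1 / R) *\<^sub>R q = real s *\<^sub>R g + (t1 + r / R) *\<^sub>R z" .
  \<comment> \<open>Then \<open>s * k\<close> is the least multiple of \<open>s\<close> strictly
    above \<open>t1\<close>; being at most \<open>t1 + s\<close>, it lies strictly below the upper
    end \<open>t1 + r / R\<close>.\<close>
  define k where "k = \<lfloor>t1 / s\<rfloor> + 1"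
  have gap: "s < r / R" using r R by (simp add: pos_less_divide_eq)
  have "t1 / s < k" "k \<le> t1 / s + 1" unfolding k_def by linarith+
  then have "t1 < s * k" "s * k \<le> t1 + s" using s by (simp_all add: field_simps)
  with gap have k: "t1 < s * k" "s * k < t1 + r / R" by linarith+
  have "real s *\<^sub>R g + (s * k) *\<^sub>R z \<in> interior P"
    by (rule convex_line_interior[OF PP(2) t0 _ _ k]) (use comb[OF xy(2) q(1)] comb[OF xy(1) q(1)] t1 t2 in auto)
  moreover have "real s *\<^sub>R g + (s * k) *\<^sub>R z = real s *\<^sub>R (g + k *\<^sub>R z)" by (simp add: scaleR_add_right)
  moreover have "g + k *\<^sub>R z \<in> int_lattice"
    by (intro add_subgroup_closed(4) add_subgroup_of_int add_subgroup_int_lattice g z)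
  ultimately show False using hollow by auto
qed

subsection \<open>Lattice polytopes of bounded volume\<close>

lemma half_open_cube_diff_int:
  assumes "x \<in> half_open_cube" "y \<in> half_open_cube" "x - y \<in> int_lattice"
  shows "x = y"
proof -
  have "x $ i = y $ i" for i
  proof -
    obtain k where k: "x $ i - y $ i = real_of_int k"
      using assms(3) by (auto simp: int_lattice_def Ints_def)
    have "\<bar>x $ i - y $ i\<bar> < 1" using assms(1,2) by (auto simp: half_open_cube_def abs_less_iff) (smt (verit))+
    with k have "k = 0" by linarith
    then show ?thesis using k by simp
  qed
  then show ?thesis by (simp add: vec_eq_iff)
qed

text \<open>If no positive multiple \<open>k g\<close> with \<open>k \<le> K\<close> were in the sublattice, then the unit cubes at
  \<open>0, g, \<dots>, K g\<close> would be disjoint modulo the sublattice, and too large for its fundamental cell.\<close>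

lemma sublattice_index_bound:
  fixes f :: "real^'n \<Rightarrow> real^'n"
  assumes f: "linear f" "inj f" "f ` int_lattice \<subseteq> int_lattice"
    and K: "measure lebesgue (f ` half_open_cube) < real K + 1" and g: "g \<in> int_lattice"
  shows "fact K *\<^sub>R g \<in> f ` int_lattice"
proof (cases "g = 0")
  case True
  have "(0::real^'n) \<in> int_lattice" by (simp add: int_lattice_def)
  then show ?thesis using True linear_0[OF f(1)] by force
next
  case False
  let ?Q = "half_open_cube :: (real^'n) set" and ?\<mu> = "measure lebesgue"
  define T where "T j = (+) (real j *\<^sub>R g) ` ?Q" for j :: nat
  have Qm: "?Q \<in> lmeasurable" using lmeasurable_linear_half_open_cube[OF linear_id] by simp
  have Tm: "T j \<in> lmeasurable" for j unfolding T_def by (rule measurable_translation[OF Qm])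
  have step: "x = y" if "x \<in> ?Q" "y \<in> ?Q" "(real i *\<^sub>R g + x) - (real j *\<^sub>R g + y) \<in> int_lattice" for x y i j
  proof (rule half_open_cube_diff_int[OF that(1,2)])
    have "real k *\<^sub>R g \<in> int_lattice" for k
      using add_subgroup_of_int[OF add_subgroup_int_lattice g, of "int k"] by simp
    then have "((real i *\<^sub>R g + x) - (real j *\<^sub>R g + y)) - real i *\<^sub>R g + real j *\<^sub>R g \<in> int_lattice"
      by (intro add_subgroup_closed(2,4)[OF add_subgroup_int_lattice] that(3))
    then show "x - y \<in> int_lattice" by (simp add: algebra_simps)
  qed
  have "disjoint_family_on T {..K}"
  proof (unfold disjoint_family_on_def, intro ballI impI, rule ccontr)
    fix i j assume ij: "i \<noteq> j" and "T i \<inter> T j \<noteq> {}"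
    then obtain x y where xy: "x \<in> ?Q" "y \<in> ?Q" "real i *\<^sub>R g + x = real j *\<^sub>R g + y" by (auto simp: T_def)
    then have "x = y" using step[of x y i j] by (simp add: int_lattice_def)
    then show False using xy(3) ij False by simp
  qed
  then have "?\<mu> (\<Union>j\<le>K. T j) = (\<Sum>j\<le>K. ?\<mu> (T j))"
    using fmeasurableD2[OF Tm] fmeasurableD[OF Tm]
    by (intro measure_finite_Union image_subsetI) auto
  also have "\<dots> = real K + 1" unfolding T_def by (simp add: measure_translation measure_half_open_cube)
  finally have vol: "?\<mu> (f ` ?Q) < ?\<mu> (\<Union>j\<le>K. T j)" using K by simp
  have "bounded ?Q" using half_open_cube_bounds(2) bounded_cbox bounded_subset by blast
  then have bd: "bounded (\<Union>j\<le>K. T j)" unfolding T_def by (intro bounded_UN) (auto intro: bounded_translation)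
  have m: "(\<Union>j\<le>K. T j) \<in> lmeasurable" using Tm by (intro fmeasurable.finite_UN) auto
  obtain x y where "x \<in> (\<Union>j\<le>K. T j)" "y \<in> (\<Union>j\<le>K. T j)" "x \<noteq> y" "x - y \<in> f ` int_lattice"
    by (rule Blichfeldt[OF f(1,2) m bd vol])
  then obtain i j p q where ij: "i \<le> K" "j \<le> K" "p \<in> ?Q" "q \<in> ?Q" "real i *\<^sub>R g + p \<noteq> real j *\<^sub>R g + q"
    "(real i *\<^sub>R g + p) - (real j *\<^sub>R g + q) \<in> f ` int_lattice"
    by (auto simp: T_def)
  then have "p = q" using step f(3) by blast
  then have neq: "i \<noteq> j" and mem: "of_int (int i - int j) *\<^sub>R g \<in> f ` int_lattice"
    using ij by (auto simp: algebra_simps)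
  \<comment> \<open>The coefficient \<open>i - j\<close> depends on \<open>g\<close>, whereas
    \<open>fact K\<close> is a common multiple of all its possible values.\<close>
  have "nat \<bar>int i - int j\<bar> dvd fact K"
    using neq ij by (intro dvd_fact) auto
  then have "int i - int j dvd int (fact K)" by (simp only: nat_abs_dvd_iff)
  then obtain c where c: "int (fact K) = (int i - int j) * c" by (rule dvdE)
  have "of_int c *\<^sub>R (of_int (int i - int j) *\<^sub>R g) \<in> f ` int_lattice"
    by (intro add_subgroup_of_int add_subgroup_linear_image f(1) add_subgroup_int_lattice mem)
  moreover have "of_int c * of_int (int i - int j) = (fact K :: real)"
    using arg_cong[OF c, of real_of_int] by (simp add: mult.commute)
  ultimately show ?thesis by simp
qed

text \<open>Linear maps preserving the integer lattice have integer matrices, and mutually inverse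
  maps give matrices inverse over the integers.\<close>

lemma unimodular_equivI:
  fixes A B :: "real^'n \<Rightarrow> real^'n"
  assumes lin: "linear A" "linear B" and inv: "\<And>x. B (A x) = x" "\<And>x. A (B x) = x"
    and int: "A ` int_lattice \<subseteq> int_lattice" "B ` int_lattice \<subseteq> int_lattice"
    and b: "b \<in> int_lattice" and Q: "Q = (\<lambda>x. A x + b) ` P"
  shows "(P, Q) \<in> unimodular_equiv"
proof -
  \<comment> \<open>The floor only changes the type: the entries are integers for the maps to which
    \<open>M\<close> is applied.\<close>
  define M where "M f = (\<chi> i j. \<lfloor>f (axis j 1) $ i\<rfloor>)" for f :: "real^'n \<Rightarrow> real^'n"
  have axis: "axis j 1 \<in> int_lattice" for j :: 'n by (auto simp: int_lattice_def axis_def)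
  have M: "map_matrix real_of_int (M f) *v x = f x"
    if "linear f" "f ` int_lattice \<subseteq> int_lattice" for f x
  proof -
    have "f (axis j 1) $ i \<in> \<int>" for i j using that(2) axis[of j] by (auto simp: int_lattice_def)
    then have "map_matrix real_of_int (M f) = matrix f" by (simp add: M_def matrix_def vec_eq_iff)
    then show ?thesis using fun_cong[OF matrix_vector_mul(2)[OF that(1)], of x] by simp
  qed
  have inj: "X = Y" if "map_matrix real_of_int X = map_matrix real_of_int Y" for X Y :: "int^'n^'n"
    using that by (simp add: vec_eq_iff)
  have "M A ** M B = mat 1" "M B ** M A = mat 1"
    by (rule inj, simp add: map_matrix_of_int_mult map_matrix_of_int_one matrix_eq
        M[OF lin(1) int(1)] M[OF lin(2) int(2)] inv flip: matrix_vector_mul_assoc)+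
  then have "invertible (M A)" unfolding invertible_def by blast
  moreover have "Q = (\<lambda>x. map_matrix real_of_int (M A) *v x + b) ` P"
    unfolding Q M[OF lin(1) int(1)] ..
  ultimately show ?thesis using b unfolding unimodular_equiv_def by blast
qed

section \<open>Normal forms and their finiteness\<close>

text \<open>The possible coordinates of generating points with respect to a maximal simplex: the
  index bound makes \<open>fact K\<close> a common denominator, and maximality confines them to the
  cube.\<close>

definition grid :: "nat \<Rightarrow> (real^'n) set" where
  "grid K = {x. fact K *\<^sub>R x \<in> int_lattice \<and> (\<forall>i. \<bar>x $ i\<bar> \<le> 1)}"

lemma finite_grid: "finite (grid K :: (real^'n) set)"
proof -
  have "norm x \<le> real CARD('n)" if "x \<in> grid K" for x :: "real^'n"
  proof -
    have "norm x \<le> (\<Sum>i\<in>UNIV. \<bar>x $ i\<bar>)" by (rule norm_le_l1_cart)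
    also have "\<dots> \<le> (\<Sum>i\<in>(UNIV :: 'n set). 1)" using that by (intro sum_mono) (auto simp: grid_def)
    finally show ?thesis by simp
  qed
  then have "(\<lambda>x. fact K *\<^sub>R x) ` (grid K :: (real^'n) set)
      \<subseteq> {z \<in> int_lattice. norm z \<le> fact K * real CARD('n)}"
    by (auto simp: grid_def)
  then have "finite ((\<lambda>x. fact K *\<^sub>R x) ` (grid K :: (real^'n) set))"
    by (rule finite_subset) (rule finite_int_lattice_bounded)
  then show ?thesis by (rule finite_imageD) (auto simp: inj_on_def)
qed

text \<open>In \<open>exists_normal_form\<close> the map \<open>f\<close> sends the unit vectors to
  the edge vectors at \<open>t\<close> of a maximal simplex, and \<open>W\<close> consists of the
  generating points of \<open>P\<close> in these coordinates.\<close>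

definition normal_form :: "nat \<Rightarrow> (real^'n) set \<Rightarrow> (real^'n \<Rightarrow> real^'n) \<Rightarrow> real^'n \<Rightarrow> (real^'n) set \<Rightarrow> bool" where
  "normal_form K P f t W \<longleftrightarrow> t \<in> int_lattice \<and> linear f \<and> inj f \<and> f ` int_lattice \<subseteq> int_lattice \<and>
     (\<forall>g\<in>int_lattice. fact K *\<^sub>R g \<in> f ` int_lattice) \<and> W \<subseteq> grid K \<and>
     P = (\<lambda>x. t + f x) ` (convex hull W)"

text \<open>The edge vectors form a tuple of maximal determinant among the differences to a fixed
  generator \<open>t\<close>. Their cell has volume at most \<open>n ^ n\<close> times that of
  \<open>P\<close>, hence below \<open>K + 1\<close>, and \<open>sublattice_index_bound\<close>
  applies.\<close>

lemma exists_normal_form: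
  fixes P :: "(real^'n) set"
  assumes lat: "lattice_polytope int_lattice P" and full: "aff_dim P = int CARD('n)"
    and vol: "real CARD('n) ^ CARD('n) * measure lebesgue P < real K + 1"
  shows "\<exists>f t W. normal_form K P f t W"
proof -
  note PP = lattice_polytope_facts[OF lat]
  obtain S where S: "finite S" "S \<subseteq> int_lattice" "P = convex hull S"
    using lat by (auto simp: lattice_polytope_def)
  have "S \<noteq> {}" using full S by auto
  then obtain t where t: "t \<in> S" by blast
  have affS: "affine hull S = UNIV" using full aff_dim_eq_full[of P] by (simp add: S(3))
  let ?S = "(\<lambda>x. x - t) ` S"
  have "span ?S = UNIV"
  proof -
    have "x \<in> span ?S" for x
    proof -
      have "t + x \<in> (+) t ` span ((\<lambda>x. - t + x) ` (S - {t}))"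
        unfolding affine_hull_span2[OF t, symmetric] affS by (rule UNIV_I)
      then have "x \<in> span ((\<lambda>x. - t + x) ` (S - {t}))" by force
      moreover have "(\<lambda>x. - t + x) ` (S - {t}) \<subseteq> ?S" by auto
      ultimately show ?thesis by (meson span_mono subsetD)
    qed
    then show ?thesis by blast
  qed
  with finite_imageI[OF S(1)]
  obtain e :: "'n \<Rightarrow> real^'n" where e: "range e \<subseteq> ?S" and nz: "det (\<chi> i j. e j $ i) \<noteq> 0"
    and coord: "\<And>x. x \<in> ?S \<Longrightarrow> \<exists>\<beta>. (\<forall>j. \<bar>\<beta> j\<bar> \<le> 1) \<and> x = (\<Sum>j\<in>UNIV. \<beta> j *\<^sub>R e j)"
    by (rule exists_max_det_subset) (rule that; assumption)
  define f where "f x = (\<Sum>j\<in>UNIV. x $ j *\<^sub>R e j)" for x :: "real^'n"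
  have f: "linear f"
    by (rule linearI) (simp_all add: f_def scaleR_add_left sum.distrib scaleR_sum_right)
  have "matrix f = (\<chi> i j. e j $ i)"
    by (simp add: matrix_def f_def vec_eq_iff axis_def if_distrib[of "\<lambda>x. x * _"] cong: if_cong)
  then have inj: "inj f" using nz det_nz_iff_inj[OF f] by simp
  have S_int: "x \<in> int_lattice" if "x \<in> ?S" for x
    using that add_subgroup_closed(2)[OF add_subgroup_int_lattice] S(2) t by auto
  have e_int: "e j \<in> int_lattice" for j using e by (intro S_int) auto
  have f_int: "f ` int_lattice \<subseteq> int_lattice"
  proof clarify
    fix x :: "real^'n" assume x: "x \<in> int_lattice"
    have "x $ j *\<^sub>R e j \<in> int_lattice" for j
      using x e_int[of j] by (auto simp: int_lattice_def intro!: Ints_mult)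
    then show "f x \<in> int_lattice" unfolding f_def by (intro add_subgroup_sum add_subgroup_int_lattice)
  qed
  let ?n = "CARD('n)" and ?\<mu> = "measure lebesgue" and ?F = "f ` (half_open_cube :: (real^'n) set)"
  \<comment> \<open>The source of \<open>n ^ n\<close>: a point of the cell, shrunk by
    \<open>1 / n\<close> and moved to \<open>t\<close>, is the average of n points, each on a
    segment from \<open>t\<close> to some \<open>t + e j\<close>.\<close>
  have small: "(\<lambda>x. (1 / ?n) *\<^sub>R x + t) ` ?F \<subseteq> P"
  proof clarify
    fix x :: "real^'n" assume x: "x \<in> half_open_cube"
    have "(1 / ?n) *\<^sub>R f x + t = (\<Sum>j\<in>UNIV. (1 / ?n) *\<^sub>R (t + x $ j *\<^sub>R e j))"
      by (simp add: f_def scaleR_add_right sum.distrib scaleR_sum_right sum_constant_scaleR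
          del: sum_constant)
    also have "\<dots> \<in> P"
    proof (rule convex_sum)
      fix j
      have "e j \<in> ?S" using e by blast
      then have "e j + t \<in> S" by auto
      then have "(1 - x $ j) *\<^sub>R t + x $ j *\<^sub>R (e j + t) \<in> P"
        using x t unfolding S(3) half_open_cube_def
        by (intro convexD[OF convex_convex_hull]) (auto intro: hull_inc less_imp_le)
      then show "t + x $ j *\<^sub>R e j \<in> P" by (simp add: algebra_simps)
    qed (use PP in auto)
    finally show "(1 / ?n) *\<^sub>R f x + t \<in> P" .
  qed
  have "?\<mu> ?F = real ?n ^ ?n * ?\<mu> ((\<lambda>x. (1 / ?n) *\<^sub>R x + t) ` ?F)"
    using measure_lebesgue_affine[of "1 / ?n" t ?F] by (simp add: power_divide)
  also have "\<dots> \<le> real ?n ^ ?n * ?\<mu> P"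
  proof (intro mult_left_mono measure_mono_fmeasurable small PP)
    have "(\<lambda>x. t + x) ` (\<lambda>x. (1 / ?n) *\<^sub>R f x) ` half_open_cube \<in> lmeasurable"
      by (intro measurable_translation lmeasurable_linear_half_open_cube linear_compose_scale_right f)
    then show "(\<lambda>x. (1 / ?n) *\<^sub>R x + t) ` ?F \<in> sets lebesgue"
      by (auto simp: image_image add.commute intro: fmeasurableD)
  qed simp
  finally have idx: "fact K *\<^sub>R g \<in> f ` int_lattice" if "g \<in> int_lattice" for g
    using sublattice_index_bound[OF f inj f_int _ that] vol by simp
  define W where "W = f -` ?S"
  have "?S \<subseteq> range f"
  proof
    fix x assume "x \<in> ?S"
    then obtain \<beta> where "x = (\<Sum>j\<in>UNIV. \<beta> j *\<^sub>R e j)" using coord by blast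
    then have "x = f (\<chi> j. \<beta> j)" by (simp add: f_def)
    then show "x \<in> range f" by blast
  qed
  then have fW: "f ` W = ?S" by (auto simp: W_def)
  have "W \<subseteq> grid K"
  proof
    fix x assume "x \<in> W"
    then have x: "f x \<in> ?S" by (simp add: W_def)
    then obtain \<beta> where \<beta>: "\<forall>j. \<bar>\<beta> j\<bar> \<le> 1" "f x = (\<Sum>j\<in>UNIV. \<beta> j *\<^sub>R e j)" using coord by blast
    then have "f x = f (\<chi> j. \<beta> j)" by (simp add: f_def)
    then have "x = (\<chi> j. \<beta> j)" using inj by (simp add: inj_eq)
    moreover have "f x \<in> int_lattice" using x by (rule S_int)
    then have "f (fact K *\<^sub>R x) \<in> f ` int_lattice" using idx by (simp add: linear_scale[OF f])
    then have "fact K *\<^sub>R x \<in> int_lattice" using inj by (auto simp: inj_eq)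
    ultimately show "x \<in> grid K" using \<beta>(1) by (simp add: grid_def)
  qed
  moreover have "P = (\<lambda>x. t + f x) ` (convex hull W)"
  proof -
    have "(\<lambda>x. t + f x) ` (convex hull W) = (+) t ` (convex hull (f ` W))"
      by (simp add: convex_hull_linear_image[OF f, symmetric] image_image)
    also have "\<dots> = convex hull ((+) t ` ?S)" by (simp add: fW convex_hull_translation)
    also have "(+) t ` ?S = S" by (simp add: image_image)
    finally show ?thesis using S(3) by simp
  qed
  moreover have "t \<in> int_lattice" using t S by blast
  ultimately show ?thesis using f inj f_int idx unfolding normal_form_def by blast
qed

text \<open>The points that \<open>f1\<close> sends into \<open>int_lattice\<close> form a
  superlattice of it with common denominator \<open>fact K\<close>. Subtracting integer parts moves
  such a point into \<open>grid K\<close>, so the superlattice is determined by its grid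
  points.\<close>

lemma normal_form_lattice_transfer:
  fixes f1 f2 :: "real^'n \<Rightarrow> real^'n"
  assumes f: "linear f1" "linear f2" "f1 ` int_lattice \<subseteq> int_lattice" "f2 ` int_lattice \<subseteq> int_lattice"
    and inj: "inj f1" and idx: "\<forall>g\<in>int_lattice. fact K *\<^sub>R g \<in> f1 ` int_lattice"
    and eq: "{x \<in> grid K. f1 x \<in> int_lattice} = {x \<in> grid K. f2 x \<in> int_lattice}"
    and x: "f1 x \<in> int_lattice"
  shows "f2 x \<in> int_lattice"
proof -
  note L = add_subgroup_closed[OF add_subgroup_int_lattice]
  define z :: "real^'n" where "z = (\<chi> i. real_of_int \<lfloor>x $ i\<rfloor>)"
  have z: "z \<in> int_lattice" by (simp add: z_def int_lattice_def)
  have "f1 (fact K *\<^sub>R x) \<in> f1 ` int_lattice" using idx x by (simp add: linear_scale[OF f(1)])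
  then have "fact K *\<^sub>R x \<in> int_lattice" using inj by (auto simp: inj_eq)
  moreover have "fact K *\<^sub>R z \<in> int_lattice"
    using add_subgroup_of_int[OF add_subgroup_int_lattice z, of "fact K"] by simp
  ultimately have "fact K *\<^sub>R (x - z) \<in> int_lattice" unfolding scaleR_diff_right by (rule L(2))
  moreover have "\<bar>(x - z) $ i\<bar> \<le> 1" for i unfolding z_def by simp linarith
  moreover have "f1 (x - z) \<in> int_lattice"
    unfolding linear_diff[OF f(1)] using f(3) x z by (intro L(2)) auto
  ultimately have "f2 (x - z) \<in> int_lattice" using eq by (auto simp: grid_def)
  then have "f2 (x - z) + f2 z \<in> int_lattice" using f(4) z by (intro L(4)) auto
  then show ?thesis by (simp add: linear_diff[OF f(2)])
qed

text \<open>The inverse of \<open>f1\<close> followed by \<open>f2\<close> carries \<open>P1\<close>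
  to a translate of \<open>P2\<close>. Agreement of the two superlattices makes this map and its
  inverse preserve the integer lattice.\<close>

lemma normal_form_unimodular_equiv:
  fixes P1 P2 :: "(real^'n) set"
  assumes n1: "normal_form K P1 f1 t1 W1" and n2: "normal_form K P2 f2 t2 W2"
    and W: "W1 = W2"
    and eq: "{x \<in> grid K. f1 x \<in> int_lattice} = {x \<in> grid K. f2 x \<in> int_lattice}"
  shows "(P1, P2) \<in> unimodular_equiv"
proof -
  note d1 = n1[unfolded normal_form_def] and d2 = n2[unfolded normal_form_def]
  have f: "linear f1" "linear f2" "inj f1" "inj f2" "f1 ` int_lattice \<subseteq> int_lattice" "f2 ` int_lattice \<subseteq> int_lattice"
    "\<forall>g\<in>int_lattice. fact K *\<^sub>R g \<in> f1 ` int_lattice" "\<forall>g\<in>int_lattice. fact K *\<^sub>R g \<in> f2 ` int_lattice"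
    using d1 d2 by auto
  obtain g1 where g1: "linear g1" "\<And>x. g1 (f1 x) = x" "\<And>x. f1 (g1 x) = x"
    using linear_injective_isomorphism[OF f(1,3)] by blast
  obtain g2 where g2: "linear g2" "\<And>x. g2 (f2 x) = x" "\<And>x. f2 (g2 x) = x"
    using linear_injective_isomorphism[OF f(2,4)] by blast
  have lin: "linear (\<lambda>x. f2 (g1 x))" "linear (\<lambda>x. f1 (g2 x))"
    using linear_compose[OF g1(1) f(2)] linear_compose[OF g2(1) f(1)] by (simp_all add: o_def)
  have int: "(\<lambda>x. f2 (g1 x)) ` int_lattice \<subseteq> int_lattice"
    using normal_form_lattice_transfer[OF f(1,2,5,6,3,7) eq] g1(3) by auto
  have int': "(\<lambda>x. f1 (g2 x)) ` int_lattice \<subseteq> int_lattice"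
    using normal_form_lattice_transfer[OF f(2,1,6,5,4,8) eq[symmetric]] g2(3) by auto
  show ?thesis
  proof (rule unimodular_equivI[OF lin _ _ int int'])
    show "t2 - f2 (g1 t1) \<in> int_lattice"
      using d1 d2 int by (intro add_subgroup_closed(2)[OF add_subgroup_int_lattice]) auto
    have P: "P1 = (\<lambda>x. t1 + f1 x) ` (convex hull W1)" "P2 = (\<lambda>x. t2 + f2 x) ` (convex hull W1)"
      using d1 d2 W by auto
    show "P2 = (\<lambda>x. f2 (g1 x) + (t2 - f2 (g1 t1))) ` P1"
      unfolding P image_image
      by (simp add: linear_add[OF g1(1)] linear_add[OF f(2)] g1(2) algebra_simps)
  qed (simp_all add: g1 g2)
qed

text \<open>Members of \<open>X\<close> with equal values of \<open>h\<close> lie in the same class,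
  so there are at most as many classes as values.\<close>

lemma finite_quotient_of_invariant:
  assumes R: "equiv UNIV R" and fin: "finite (h ` X)"
    and h: "\<And>x y. x \<in> X \<Longrightarrow> y \<in> X \<Longrightarrow> h x = h y \<Longrightarrow> (x, y) \<in> R"
  shows "finite (X // R)"
proof -
  have "X // R \<subseteq> (\<lambda>i. R `` {inv_into X h i}) ` h ` X"
  proof
    fix c assume "c \<in> X // R"
    then obtain x where x: "x \<in> X" "c = R `` {x}" by (rule quotientE)
    have "(x, inv_into X h (h x)) \<in> R"
      using x(1) by (intro h) (auto simp: inv_into_into f_inv_into_f)
    then have "c = R `` {inv_into X h (h x)}" unfolding x(2) by (rule equiv_class_eq[OF R])
    then show "c \<in> (\<lambda>i. R `` {inv_into X h i}) ` h ` X" using x(1) by blast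
  qed
  then show ?thesis by (rule finite_subset) (intro finite_imageI fin)
qed

text \<open>The class of a polytope is determined by two subsets of one finite grid: the generating
  points of a normal form, and the grid points that its map sends into
  \<open>int_lattice\<close>.\<close>

lemma finite_bounded_volume_lattice_polytopes:
  fixes X :: "(real^'n) set set"
  assumes X: "\<And>P. P \<in> X \<Longrightarrow> lattice_polytope int_lattice P \<and> aff_dim P = int CARD('n) \<and> measure lebesgue P \<le> B"
  shows "finite (X // unimodular_equiv)"
proof -
  \<comment> \<open>Taking the floor puts \<open>n ^ n * B\<close> below \<open>K + 1\<close>, as
    \<open>exists_normal_form\<close> requires.\<close>
  define K where "K = nat \<lfloor>real CARD('n) ^ CARD('n) * B\<rfloor>"
  have nf: "\<exists>f t W. normal_form K P f t W" if "P \<in> X" for P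
  proof (rule exists_normal_form)
    have "real CARD('n) ^ CARD('n) * measure lebesgue P \<le> real CARD('n) ^ CARD('n) * B"
      using X[OF that] by (intro mult_left_mono) auto
    also have "\<dots> < real K + 1" unfolding K_def by linarith
    finally show "real CARD('n) ^ CARD('n) * measure lebesgue P < real K + 1" .
  qed (use X[OF that] in auto)
  \<comment> \<open>A polytope may have several normal forms; the choice fixes one code for each
    polytope.\<close>
  define code where "code P = (SOME c. \<exists>f t. normal_form K P f t (fst c) \<and> snd c = {x \<in> grid K. f x \<in> int_lattice})" for P :: "(real^'n) set"
  have code: "\<exists>f t. normal_form K P f t (fst (code P)) \<and> snd (code P) = {x \<in> grid K. f x \<in> int_lattice}"
    if P: "P \<in> X" for P
  proof -
    obtain f t W where "normal_form K P f t W" using nf[OF P] by blast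
    then have "\<exists>c. \<exists>f t. normal_form K P f t (fst c) \<and> snd c = {x \<in> grid K. f x \<in> int_lattice}"
      by (intro exI[of _ "(W, {x \<in> grid K. f x \<in> int_lattice})"] exI[of _ f] exI[of _ t]) auto
    then show ?thesis unfolding code_def by (rule someI_ex)
  qed
  show ?thesis
  proof (rule finite_quotient_of_invariant[OF equiv_unimodular_equiv, where h = code])
    have "code ` X \<subseteq> Pow (grid K) \<times> Pow (grid K)"
    proof (rule image_subsetI)
      fix P assume "P \<in> X"
      then show "code P \<in> Pow (grid K) \<times> Pow (grid K)"
        using code[of P] unfolding normal_form_def mem_Times_iff by auto
    qed
    then show "finite (code ` X)" by (rule finite_subset) (simp add: finite_grid)
    fix P Q assume PQ: "P \<in> X" "Q \<in> X" "code P = code Q"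
    obtain f1 t1 where 1: "normal_form K P f1 t1 (fst (code P))"
      "snd (code P) = {x \<in> grid K. f1 x \<in> int_lattice}"
      using code[OF PQ(1)] by blast
    obtain f2 t2 where 2: "normal_form K Q f2 t2 (fst (code Q))"
      "snd (code Q) = {x \<in> grid K. f2 x \<in> int_lattice}"
      using code[OF PQ(2)] by blast
    show "(P, Q) \<in> unimodular_equiv"
      by (rule normal_form_unimodular_equiv[OF 1(1) 2(1)]) (use PQ(3) 1(2) 2(2) in auto)
  qed
qed

theorem theorem2p1:
  fixes s d :: nat
  assumes "s \<ge> 1" and "d = CARD('d::finite)"
  shows "finite ({P :: (real^'d) set. s_hollow_d_polytope s P \<and> \<not> projects_to_s_hollow (d - 1) s P}
             // unimodular_equiv)
    \<and> (\<forall>P :: (real^'d) set. s_hollow_d_polytope s P \<and> \<not> projects_to_s_hollow (d - 1) s P \<longrightarrow>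
          measure lebesgue P
            \<le> real s ^ d * (8 * (real d - 1) * (8 * real s + 7) ^ (2 ^ (2 * d - 1)) + 1) ^ d)"
proof
  show vol: "\<forall>P :: (real^'d) set. s_hollow_d_polytope s P \<and> \<not> projects_to_s_hollow (d - 1) s P \<longrightarrow>
      measure lebesgue P
        \<le> real s ^ d * (8 * (real d - 1) * (8 * real s + 7) ^ (2 ^ (2 * d - 1)) + 1) ^ d"
    using volume_bound[where 'n = 'd, OF assms(1)] unfolding assms(2) by blast
  show "finite ({P :: (real^'d) set. s_hollow_d_polytope s P \<and> \<not> projects_to_s_hollow (d - 1) s P}
      // unimodular_equiv)"
    by (rule finite_bounded_volume_lattice_polytopes) (use vol in \<open>auto simp: s_hollow_d_polytope_def\<close>)
qed

end
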